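(* Let $\mathcal H$ be a reproducing kernel Hilbert space on a set $X$ whose reproducing kernel $k$ satisfies $k(z,z)\neq 0$ for all $z\in X$ and is an irreducible complete Nevanlinna-Pick kernel. Let $(\lambda_i)$ be a sequence in $X$ such that (S) there is $c>0$ with $d_{\mathcal H}(\lambda_n,\lambda_m)\ge c$ for all $n\neq m$; and (C) there is $c'>0$ with $\sum_i \frac{|f(\lambda_i)|^2}{\|k_{\lambda_i}\|^2}\le c'\|f\|^2$ for all $f\in\mathcal H$. Then $(\lambda_i)$ is an interpolating sequence for $\operatorname{Mult}(\mathcal H)$, i.e. for every bounded sequence $(w_i)$ of complex numbers there is $\phi\in\operatorname{Mult}(\mathcal H)$ with $\phi(\lambda_i)=w_i$ for every $i$.
   Context: Write $k_w(z)=k(z,w)$ for the reproducing kernel, so $f(w)=\langle f,k_w\rangle$ for $f \in \mathcal H$. $\operatorname{Mult}(\mathcal H)$ is the algebra of functions $\phi:X\to\mathbb C$ such that $\phi f\in\mathcal H$ for all $f\in\mathcal H$. The pseudo metric is $d_{\mathcal H}(z,w)=\sqrt{1-\frac{|\langle k_z,k_w\rangle|^2}{\|k_z\|^2\|k_w\|^2}}$. The kernel $k$ is irreducible if $X$ cannot be partitioned into two disjoint non-empty sets $X_1,X_2$ with $k(x_1,x_2)=0$ for all $x_1\in X_1$, $x_2\in X_2$. The kernel $k$ has the complete Pick (complete Nevanlinna-Pick) property if for every $n\ge1$, all finite sequences of distinct points $\lambda_1,\dots,\lambda_N\in X$ and all complex $n\times n$ matrices $W_1,\dots,W_N$: whenever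 the block matrix $\big[k(\lambda_i,\lambda_j)(I_{\mathbb C^n}-W_iW_j^* )\big]_{i,j=1}^N$ is positive semi-definite, there is a multiplier $\Phi$ of $\mathcal H\otimes\mathbb C^n$ (an $n \times n$ matrix valued function acting by multiplication) of norm at most $1$ with $\Phi(\lambda_i)=W_i$ for all $i$. An irreducible complete Nevanlinna-Pick kernel is an irreducible kernel with the complete Pick property; equivalently, it is a kernel of the form $k(z,w)=\frac{f(z)\overline{f(w)}}{1-\langle b(z),b(w)\rangle_{\mathcal K}}$ with $f:X\to\mathbb C$ non-vanishing and $b$ a map from $X$ into the open unit ball of an auxiliary Hilbert space $\mathcal K$. *)

theory Defs
  imports Complex_Main "Jordan_Normal_Form.Schur_Decomposition"
begin

text \<open>
  A reproducing kernel Hilbert space on a set \<open>X\<close> is given by its set \<open>H\<close> of functions, its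
  inner product \<open>ip\<close> (linear in the first argument; only its values on \<open>H\<close> matter) and its
  reproducing kernel \<open>k\<close>. A function on \<open>X\<close> is represented by the function on the whole type
  that is zero outside \<open>X\<close>, so that the vector space operations are the pointwise ones.
\<close>

definition kernel_fun :: "('x \<Rightarrow> 'x \<Rightarrow> complex) \<Rightarrow> 'x \<Rightarrow> 'x \<Rightarrow> complex" where
  "kernel_fun k w = (\<lambda>z. k z w)"

definition ip_norm ::
  "(('x \<Rightarrow> complex) \<Rightarrow> ('x \<Rightarrow> complex) \<Rightarrow> complex) \<Rightarrow> ('x \<Rightarrow> complex) \<Rightarrow> real" where
  "ip_norm ip f = sqrt (Re (ip f f))"

locale rkhs =
  fixes X :: "'x set"
    and H :: "('x \<Rightarrow> complex) set"
    and ip :: "('x \<Rightarrow> complex) \<Rightarrow> ('x \<Rightarrow> complex) \<Rightarrow> complex"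
    and k :: "'x \<Rightarrow> 'x \<Rightarrow> complex"
  assumes zero_outside: "\<And>f x. f \<in> H \<Longrightarrow> x \<notin> X \<Longrightarrow> f x = 0"
    and zero_mem: "(\<lambda>x. 0) \<in> H"
    and add_mem: "\<And>f g. f \<in> H \<Longrightarrow> g \<in> H \<Longrightarrow> (\<lambda>x. f x + g x) \<in> H"
    and scale_mem: "\<And>c f. f \<in> H \<Longrightarrow> (\<lambda>x. c * f x) \<in> H"
    and ip_add: "\<And>f g h. f \<in> H \<Longrightarrow> g \<in> H \<Longrightarrow> h \<in> H \<Longrightarrow>
      ip (\<lambda>x. f x + g x) h = ip f h + ip g h"
    and ip_scale: "\<And>c f g. f \<in> H \<Longrightarrow> g \<in> H \<Longrightarrow> ip (\<lambda>x. c * f x) g = c * ip f g"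
    and ip_commute: "\<And>f g. f \<in> H \<Longrightarrow> g \<in> H \<Longrightarrow> ip g f = cnj (ip f g)"
    and ip_pos: "\<And>f. f \<in> H \<Longrightarrow> f \<noteq> (\<lambda>x. 0) \<Longrightarrow> 0 < Re (ip f f)"
    and complete: "\<And>F. (\<And>n. F n \<in> H) \<Longrightarrow>
      (\<And>e. 0 < e \<Longrightarrow> \<exists>M. \<forall>m\<ge>M. \<forall>n\<ge>M. ip_norm ip (\<lambda>x. F m x - F n x) < e) \<Longrightarrow>
      \<exists>f\<in>H. (\<lambda>n. ip_norm ip (\<lambda>x. F n x - f x)) \<longlonglongrightarrow> 0"
    and kernel_mem: "\<And>w. w \<in> X \<Longrightarrow> kernel_fun k w \<in> H"
    and reproducing: "\<And>f w. f \<in> H \<Longrightarrow> w \<in> X \<Longrightarrow> f w = ip f (kernel_fun k w)"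

definition kernel_dist ::
  "(('x \<Rightarrow> complex) \<Rightarrow> ('x \<Rightarrow> complex) \<Rightarrow> complex) \<Rightarrow> ('x \<Rightarrow> 'x \<Rightarrow> complex) \<Rightarrow> 'x \<Rightarrow> 'x \<Rightarrow> real" where
  "kernel_dist ip k z w =
    sqrt (1 - (cmod (ip (kernel_fun k z) (kernel_fun k w)))\<^sup>2 /
      ((ip_norm ip (kernel_fun k z))\<^sup>2 * (ip_norm ip (kernel_fun k w))\<^sup>2))"

definition Mult :: "'x set \<Rightarrow> ('x \<Rightarrow> complex) set \<Rightarrow> ('x \<Rightarrow> complex) set" where
  "Mult X H = {\<phi>. (\<forall>x. x \<notin> X \<longrightarrow> \<phi> x = 0) \<and> (\<forall>f\<in>H. (\<lambda>x. \<phi> x * f x) \<in> H)}"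

definition irreducible_kernel :: "'x set \<Rightarrow> ('x \<Rightarrow> 'x \<Rightarrow> complex) \<Rightarrow> bool" where
  "irreducible_kernel X k \<longleftrightarrow>
    \<not> (\<exists>X1 X2. X1 \<union> X2 = X \<and> X1 \<inter> X2 = {} \<and> X1 \<noteq> {} \<and> X2 \<noteq> {} \<and>
          (\<forall>x1\<in>X1. \<forall>x2\<in>X2. k x1 x2 = 0))"

text \<open>
  The Hilbert space \<open>H \<otimes> \<complex>\<^sup>n\<close> is the direct sum of \<open>n\<close> copies of \<open>H\<close>, regarded as a space of
  \<open>\<complex>\<^sup>n\<close>-valued functions.
\<close>

definition tensor_space :: "('x \<Rightarrow> complex) set \<Rightarrow> nat \<Rightarrow> ('x \<Rightarrow> complex vec) set" where
  "tensor_space H n =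
    {F. (\<forall>x. F x \<in> carrier_vec n) \<and> (\<forall>a<n. (\<lambda>x. vec_index (F x) a) \<in> H)}"

definition tensor_norm ::
  "(('x \<Rightarrow> complex) \<Rightarrow> ('x \<Rightarrow> complex) \<Rightarrow> complex) \<Rightarrow> nat \<Rightarrow> ('x \<Rightarrow> complex vec) \<Rightarrow> real" where
  "tensor_norm ip n F = sqrt (\<Sum>a<n. (ip_norm ip (\<lambda>x. vec_index (F x) a))\<^sup>2)"

definition contractive_multiplier ::
  "'x set \<Rightarrow> ('x \<Rightarrow> complex) set \<Rightarrow> (('x \<Rightarrow> complex) \<Rightarrow> ('x \<Rightarrow> complex) \<Rightarrow> complex) \<Rightarrow>
    nat \<Rightarrow> ('x \<Rightarrow> complex mat) \<Rightarrow> bool" where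
  "contractive_multiplier X H ip n \<Phi> \<longleftrightarrow>
    (\<forall>x. \<Phi> x \<in> carrier_mat n n) \<and> (\<forall>x. x \<notin> X \<longrightarrow> \<Phi> x = 0\<^sub>m n n) \<and>
    (\<forall>F\<in>tensor_space H n.
       (\<lambda>x. \<Phi> x *\<^sub>v F x) \<in> tensor_space H n \<and>
       tensor_norm ip n (\<lambda>x. \<Phi> x *\<^sub>v F x) \<le> tensor_norm ip n F)"

text \<open>
  Positive semi-definiteness of the \<open>N \<times> N\<close> block matrix with \<open>n \<times> n\<close> blocks \<open>B i j\<close>; the
  relation \<open>0 \<le> z\<close> on complex numbers says that \<open>z\<close> is real and nonnegative.
\<close>

definition block_psd :: "nat \<Rightarrow> nat \<Rightarrow> (nat \<Rightarrow> nat \<Rightarrow> complex mat) \<Rightarrow> bool" where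
  "block_psd N n B \<longleftrightarrow>
    (\<forall>v. (\<forall>i<N. v i \<in> carrier_vec n) \<longrightarrow>
       0 \<le> (\<Sum>i<N. \<Sum>j<N. (B i j *\<^sub>v v j) \<bullet>c v i))"

definition complete_pick ::
  "'x set \<Rightarrow> ('x \<Rightarrow> complex) set \<Rightarrow> (('x \<Rightarrow> complex) \<Rightarrow> ('x \<Rightarrow> complex) \<Rightarrow> complex) \<Rightarrow>
    ('x \<Rightarrow> 'x \<Rightarrow> complex) \<Rightarrow> bool" where
  "complete_pick X H ip k \<longleftrightarrow>
    (\<forall>n\<ge>1. \<forall>N. \<forall>(pts :: nat \<Rightarrow> 'x) (W :: nat \<Rightarrow> complex mat).
       inj_on pts {..<N} \<and> (\<forall>i<N. pts i \<in> X) \<and> (\<forall>i<N. W i \<in> carrier_mat n n) \<and>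
       block_psd N n (\<lambda>i j. k (pts i) (pts j) \<cdot>\<^sub>m (1\<^sub>m n - W i * mat_adjoint (W j)))
       \<longrightarrow> (\<exists>\<Phi>. contractive_multiplier X H ip n \<Phi> \<and> (\<forall>i<N. \<Phi> (pts i) = W i)))"

definition interpolating_sequence ::
  "'x set \<Rightarrow> ('x \<Rightarrow> complex) set \<Rightarrow> (nat \<Rightarrow> 'x) \<Rightarrow> bool" where
  "interpolating_sequence X H pts \<longleftrightarrow>
    (\<forall>w :: nat \<Rightarrow> complex. Bseq w \<longrightarrow> (\<exists>\<phi>\<in>Mult X H. \<forall>i. \<phi> (pts i) = w i))"

end

theory Submission
  imports Defs
begin

text \<open>
  The complete Pick property forces the McCullough--Quiggin condition: on a finite set, the kernel
  normalized at a point \<open>y\<close> has the form \<open>1 / (1 - \<langle>b x, b z\<rangle>)\<close>. It follows that \<open>1 - g w\<close>, where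
  \<open>g w x = k x w * k w y / (k x y * k w w)\<close>, is a contractive multiplier, which makes multiplication
  by \<open>g w\<close> accretive with \<open>2 Re (g w) \<ge> (g w) (g w)\<^sup>*\<close>.

  Condition (C) bounds the Gram matrix of the normalized kernel functions from above. Averaging this
  bound produces an enumeration of any finite set of points along which the sums of
  \<open>Re (g i (\<lambda> j))\<close> over \<open>i \<ge> j\<close> are uniformly bounded. As in Jones' interpolation formula, put
  \<open>F j = \<phi> j * g j * (\<Prod>i>j. 1 - g i / 8)\<close>, where \<open>\<phi> j\<close> is a product of two-point Pick multipliers that
  vanishes at all other points; (S) and (C) bound \<open>F j (\<lambda> j)\<close> from below. The products telescope, so
  that \<open>\<Sum>j. (F j) (F j)\<^sup>*\<close> is bounded, and this bounds the Gram matrix from below.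

  Two-sided Gram bounds solve every interpolation problem with bounded data on finitely many points
  by the scalar Pick property, with a uniform bound for the multipliers, and a limit of such
  multipliers solves the infinite problem.
\<close>

section \<open>The quadratic form of a kernel\<close>

definition kcomb :: "('x \<Rightarrow> 'x \<Rightarrow> complex) \<Rightarrow> 'x set \<Rightarrow> ('x \<Rightarrow> complex) \<Rightarrow> 'x \<Rightarrow> complex" where
  "kcomb k S c = (\<lambda>z. \<Sum>y\<in>S. c y * k z y)"

text \<open>The squared norm of \<open>kcomb k S c\<close>, expressed by kernel values alone. For
  finite \<open>S \<subseteq> X\<close> the double sum is real, so the real part loses nothing
  there.\<close>

definition ksq :: "('x \<Rightarrow> 'x \<Rightarrow> complex) \<Rightarrow> 'x set \<Rightarrow> ('x \<Rightarrow> complex) \<Rightarrow> real" where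
  "ksq k S c = Re (\<Sum>x\<in>S. \<Sum>y\<in>S. cnj (c x) * c y * k x y)"

text \<open>The adjoint of multiplication by \<open>\<phi>\<close> maps \<open>\<Sum>x\<in>S. c x k\<^sub>x\<close> to \<open>\<Sum>x\<in>S. c x (\<phi> x)\<^sup>* k\<^sub>x\<close>, so the
  following conditions say that it is a contraction on the span of the kernel functions of \<open>S\<close>.\<close>

definition kcontr :: "('x \<Rightarrow> 'x \<Rightarrow> complex) \<Rightarrow> 'x set \<Rightarrow> ('x \<Rightarrow> complex) \<Rightarrow> bool" where
  "kcontr k S \<phi> \<longleftrightarrow> (\<forall>c. ksq k S (\<lambda>x. c x * cnj (\<phi> x)) \<le> ksq k S c)"

definition row_contr ::
  "('x \<Rightarrow> 'x \<Rightarrow> complex) \<Rightarrow> 'x set \<Rightarrow> nat \<Rightarrow> ('x \<Rightarrow> nat \<Rightarrow> complex) \<Rightarrow> bool" where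
  "row_contr k S n B \<longleftrightarrow>
    (\<forall>c. (\<Sum>a<n. ksq k S (\<lambda>x. c x * cnj (B x a))) \<le> ksq k S c)"

lemma row_contr_1: "row_contr k S 1 B \<longleftrightarrow> kcontr k S (\<lambda>x. B x 0)"
  unfolding row_contr_def kcontr_def by (simp add: lessThan_Suc)

text \<open>Contractivity of a row is positivity of its Pick matrix: the deficit of the squared
  norms is the form of the kernel multiplied entrywise by one minus the Gram matrix of the row.
  Contractions are verified and exploited below through this form.\<close>

lemma row_contr_eq:
  "ksq k S c - (\<Sum>a<n. ksq k S (\<lambda>x. c x * cnj (B x a))) =
    Re (\<Sum>x\<in>S. \<Sum>y\<in>S. cnj (c x) * c y * (k x y * (1 - (\<Sum>a<n. B x a * cnj (B y a)))))"
proof -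
  have "(\<Sum>a<n. ksq k S (\<lambda>x. c x * cnj (B x a))) =
     Re (\<Sum>a<n. \<Sum>x\<in>S. \<Sum>y\<in>S. cnj (c x) * c y * k x y * (B x a * cnj (B y a)))"
    unfolding ksq_def Re_sum by (intro sum.cong refl arg_cong[where f=Re]) (simp add: algebra_simps)
  also have "(\<Sum>a<n. \<Sum>x\<in>S. \<Sum>y\<in>S. cnj (c x) * c y * k x y * (B x a * cnj (B y a))) =
     (\<Sum>x\<in>S. \<Sum>y\<in>S. \<Sum>a<n. cnj (c x) * c y * k x y * (B x a * cnj (B y a)))"
    by (subst sum.swap, rule sum.cong[OF refl], rule sum.swap)
  also have "\<dots> = (\<Sum>x\<in>S. \<Sum>y\<in>S. cnj (c x) * c y * k x y * (\<Sum>a<n. B x a * cnj (B y a)))"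
    by (simp add: sum_distrib_left)
  finally show ?thesis
    unfolding ksq_def
    by (simp only: minus_complex.sel(1)[symmetric] sum_subtractf[symmetric] right_diff_distrib
        mult_1_right mult.assoc)
qed

lemma kcontr_eq:
  "ksq k S c - ksq k S (\<lambda>x. c x * cnj (\<phi> x)) =
    Re (\<Sum>x\<in>S. \<Sum>y\<in>S. cnj (c x) * c y * (k x y * (1 - \<phi> x * cnj (\<phi> y))))"
  using row_contr_eq[of k S c "\<lambda>x a. \<phi> x" "Suc 0"]
  by (simp only: sum.lessThan_Suc lessThan_0 sum.empty add_0_left)

lemma kcontr_mult:
  assumes "kcontr k S f" "kcontr k S g"
  shows "kcontr k S (\<lambda>x. f x * g x)"
  unfolding kcontr_def
proof
  fix c
  have "ksq k S (\<lambda>x. c x * cnj (f x * g x)) = ksq k S (\<lambda>x. (c x * cnj (f x)) * cnj (g x))"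
    by (simp add: mult.assoc)
  also have "\<dots> \<le> ksq k S (\<lambda>x. c x * cnj (f x))"
    using assms(2) unfolding kcontr_def by (rule spec)
  also have "\<dots> \<le> ksq k S c"
    using assms(1) unfolding kcontr_def by blast
  finally show "ksq k S (\<lambda>x. c x * cnj (f x * g x)) \<le> ksq k S c" .
qed

lemma kcontr_prod:
  assumes "finite I" "\<And>i. i \<in> I \<Longrightarrow> kcontr k S (f i)"
  shows "kcontr k S (\<lambda>x. \<Prod>i\<in>I. f i x)"
  using assms
proof (induction I rule: finite_induct)
  case empty
  then show ?case by (simp add: kcontr_def)
next
  case (insert i I)
  then show ?case using kcontr_mult[of k S "f i"] by simp
qed

lemma ksq_single:
  assumes "finite S" "x \<in> S" "\<And>y. y \<in> S \<Longrightarrow> y \<noteq> x \<Longrightarrow> c y = 0"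
  shows "ksq k S c = (cmod (c x))\<^sup>2 * Re (k x x)"
proof -
  have "(\<Sum>u\<in>S. \<Sum>y\<in>S. cnj (c u) * c y * k u y) = (\<Sum>u\<in>{x}. \<Sum>y\<in>S. cnj (c u) * c y * k u y)"
    using assms by (intro sum.mono_neutral_right) auto
  also have "\<dots> = (\<Sum>y\<in>S. cnj (c x) * c y * k x y)"
    by simp
  also have "\<dots> = (\<Sum>y\<in>{x}. cnj (c x) * c y * k x y)"
    using assms by (intro sum.mono_neutral_right) auto
  also have "\<dots> = of_real ((cmod (c x))\<^sup>2) * k x x"
    using complex_norm_square[of "c x"] by (simp add: mult.commute)
  finally show ?thesis unfolding ksq_def by simp
qed

text \<open>The Hilbert space identity for the squared norm of a convex combination. The subtracted
  term is the gain that telescopes in \<open>telescoping_row\<close>.\<close>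

lemma ksq_convex_comb:
  "ksq k S (\<lambda>x. (1 - of_real s) * a x + of_real s * b x) =
    (1 - s) * ksq k S a + s * ksq k S b - s * (1 - s) * ksq k S (\<lambda>x. a x - b x)"
proof -
  have "(1 - s) * ksq k S a + s * ksq k S b - s * (1 - s) * ksq k S (\<lambda>x. a x - b x) =
    Re (of_real (1 - s) * (\<Sum>x\<in>S. \<Sum>y\<in>S. cnj (a x) * a y * k x y)
      + of_real s * (\<Sum>x\<in>S. \<Sum>y\<in>S. cnj (b x) * b y * k x y)
      - of_real (s * (1 - s)) * (\<Sum>x\<in>S. \<Sum>y\<in>S. cnj (a x - b x) * (a y - b y) * k x y))"
    unfolding ksq_def by simp
  also have "\<dots> = ksq k S (\<lambda>x. (1 - of_real s) * a x + of_real s * b x)"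
    unfolding ksq_def sum_distrib_left sum.distrib[symmetric] sum_subtractf[symmetric]
    by (intro sum.cong refl arg_cong[where f=Re]) (simp add: algebra_simps)
  finally show ?thesis by simp
qed

section \<open>Inner products with combinations of kernel functions\<close>

context rkhs
begin

lemma sum_mem:
  assumes "finite S" "\<And>y. y \<in> S \<Longrightarrow> f y \<in> H"
  shows "(\<lambda>z. \<Sum>y\<in>S. f y z) \<in> H"
  using assms by (induction S rule: finite_induct) (auto intro: zero_mem add_mem)

lemma diff_mem: "f \<in> H \<Longrightarrow> g \<in> H \<Longrightarrow> (\<lambda>x. f x - g x) \<in> H"
  using add_mem[of f "\<lambda>x. (-1) * g x"] scale_mem[of g "-1"] by simp

lemma ip_add_right:
  assumes "f \<in> H" "g \<in> H" "h \<in> H"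
  shows "ip h (\<lambda>x. f x + g x) = ip h f + ip h g"
proof -
  have "ip h (\<lambda>x. f x + g x) = cnj (ip (\<lambda>x. f x + g x) h)"
    using assms ip_commute add_mem by blast
  also have "\<dots> = ip h f + ip h g"
    using assms by (simp add: ip_add ip_commute[of h])
  finally show ?thesis .
qed

lemma ip_scale_right:
  assumes "f \<in> H" "h \<in> H"
  shows "ip h (\<lambda>x. c * f x) = cnj c * ip h f"
proof -
  have "ip h (\<lambda>x. c * f x) = cnj (ip (\<lambda>x. c * f x) h)"
    using assms ip_commute scale_mem by blast
  then show ?thesis using assms by (simp add: ip_scale ip_commute[of h])
qed

lemma ip_diff: "f \<in> H \<Longrightarrow> g \<in> H \<Longrightarrow> h \<in> H \<Longrightarrow> ip (\<lambda>x. f x - g x) h = ip f h - ip g h"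
  using ip_add[of f "\<lambda>x. (-1) * g x" h] ip_scale[of g h "-1"] scale_mem[of g "-1"] by simp

lemma ip_diff_right: "f \<in> H \<Longrightarrow> g \<in> H \<Longrightarrow> h \<in> H \<Longrightarrow> ip h (\<lambda>x. f x - g x) = ip h f - ip h g"
  using ip_add_right[of f "\<lambda>x. (-1) * g x" h] ip_scale_right[of g h "-1"] scale_mem[of g "-1"] by simp

lemma ip_zero: "f \<in> H \<Longrightarrow> ip (\<lambda>x. 0) f = 0"
  using ip_scale[OF zero_mem, of f 0] by simp

lemma ip_zero_right: "f \<in> H \<Longrightarrow> ip f (\<lambda>x. 0) = 0"
  using ip_scale_right[OF zero_mem, of f 0] by simp

lemma ip_nonneg: "f \<in> H \<Longrightarrow> 0 \<le> Re (ip f f)"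
  using ip_pos[of f] ip_zero[OF zero_mem] by (cases "f = (\<lambda>x. 0)") auto

lemma ip_norm_sq: "f \<in> H \<Longrightarrow> (ip_norm ip f)\<^sup>2 = Re (ip f f)"
  unfolding ip_norm_def using ip_nonneg by simp

lemma ip_self_real: "f \<in> H \<Longrightarrow> ip f f = of_real (Re (ip f f))"
  using ip_commute[of f f] by (simp add: complex_eq_iff)

lemma kernel_hermitian: "x \<in> X \<Longrightarrow> y \<in> X \<Longrightarrow> k y x = cnj (k x y)"
  using reproducing[OF kernel_mem, of y x] reproducing[OF kernel_mem, of x y]
    ip_commute[OF kernel_mem kernel_mem, of x y]
  unfolding kernel_fun_def by simp

lemma ip_kernels: "x \<in> X \<Longrightarrow> y \<in> X \<Longrightarrow> ip (kernel_fun k y) (kernel_fun k x) = k x y"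
  using reproducing[OF kernel_mem, of y x] unfolding kernel_fun_def by simp

lemma kernel_norm_sq: "x \<in> X \<Longrightarrow> (ip_norm ip (kernel_fun k x))\<^sup>2 = Re (k x x)"
  by (simp add: ip_norm_sq kernel_mem ip_kernels)

lemma kcomb_mem: "finite S \<Longrightarrow> S \<subseteq> X \<Longrightarrow> kcomb k S c \<in> H"
  unfolding kcomb_def using kernel_mem
  by (intro sum_mem scale_mem) (auto simp: kernel_fun_def)

lemma ip_kcomb:
  assumes "finite S" "S \<subseteq> X" "f \<in> H"
  shows "ip f (kcomb k S c) = (\<Sum>y\<in>S. cnj (c y) * f y)"
  using assms(1,2)
proof (induction S rule: finite_induct)
  case empty
  then show ?case using assms(3) by (simp add: kcomb_def ip_zero_right)
next
  case (insert y S)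
  have "kcomb k (insert y S) c = (\<lambda>z. c y * kernel_fun k y z + kcomb k S c z)"
    using insert unfolding kcomb_def kernel_fun_def by auto
  moreover have "(\<lambda>z. c y * kernel_fun k y z) \<in> H"
    using insert by (intro scale_mem kernel_mem) auto
  ultimately have "ip f (kcomb k (insert y S) c) =
      cnj (c y) * ip f (kernel_fun k y) + ip f (kcomb k S c)"
    using insert assms(3) by (simp add: ip_add_right kcomb_mem ip_scale_right kernel_mem)
  then show ?case using insert assms(3) by (simp add: reproducing[symmetric])
qed

lemma ip_kcomb_self:
  assumes "finite S" "S \<subseteq> X"
  shows "ip (kcomb k S c) (kcomb k S c) = (\<Sum>x\<in>S. \<Sum>y\<in>S. cnj (c x) * c y * k x y)"
  by (simp add: ip_kcomb[OF assms kcomb_mem[OF assms]])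
     (simp add: kcomb_def sum_distrib_left mult.assoc)

lemma ksq_eq_ip: "finite S \<Longrightarrow> S \<subseteq> X \<Longrightarrow> ksq k S c = Re (ip (kcomb k S c) (kcomb k S c))"
  by (simp add: ip_kcomb_self ksq_def)

lemma ksq_nonneg: "finite S \<Longrightarrow> S \<subseteq> X \<Longrightarrow> 0 \<le> ksq k S c"
  by (simp add: ksq_eq_ip ip_nonneg kcomb_mem)

lemma kernel_sum_Im:
  assumes "finite S" "S \<subseteq> X"
  shows "Im (\<Sum>x\<in>S. \<Sum>y\<in>S. cnj (c x) * c y * k x y) = 0"
  using arg_cong[where f=Im, OF ip_self_real[OF kcomb_mem[OF assms, of c]]]
  unfolding ip_kcomb_self[OF assms] Im_complex_of_real .

lemma kernel_diag_real: "x \<in> X \<Longrightarrow> k x x = of_real (Re (k x x))"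
  using kernel_hermitian[of x x] by (simp add: complex_eq_iff)

lemma kernel_diag_pos: "x \<in> X \<Longrightarrow> k x x \<noteq> 0 \<Longrightarrow> 0 < Re (k x x)"
  using ip_nonneg[OF kernel_mem, of x] kernel_diag_real[of x] ip_kernels[of x x]
  by (cases "Re (k x x) = 0") auto

text \<open>Cauchy-Schwarz for \<open>f\<close> and the kernel function at \<open>x\<close>: their
  inner product is \<open>f x\<close>, and \<open>k x x\<close> is the squared norm of the
  latter.\<close>

lemma point_evaluation_bound:
  assumes "f \<in> H" "x \<in> X"
  shows "(cmod (f x))\<^sup>2 \<le> Re (ip f f) * Re (k x x)"
proof (cases "k x x = 0")
  case True
  have "kernel_fun k x = (\<lambda>z. 0)"
    using ip_pos[OF kernel_mem[OF assms(2)]] ip_kernels[of x x] assms True by force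
  then have "f x = 0" using reproducing[OF assms] ip_zero_right[OF assms(1)] by simp
  then show ?thesis using True by simp
next
  case False
  define K where "K = Re (k x x)"
  have K: "k x x = of_real K" "0 < K"
    using kernel_diag_real kernel_diag_pos False assms by (auto simp: K_def)
  \<comment> \<open>With this \<open>t\<close>, \<open>g\<close> is the orthogonal projection of
    \<open>f\<close> onto the line spanned by the kernel function at \<open>x\<close>.\<close>
  define t where "t = f x / of_real K"
  define g where "g = (\<lambda>z. t * kernel_fun k x z)"
  have g: "g \<in> H" unfolding g_def using assms by (intro scale_mem kernel_mem)
  have "ip f g = cnj t * f x"
    unfolding g_def using assms by (simp add: ip_scale_right kernel_mem reproducing[symmetric])
  moreover have "ip g g = t * cnj t * of_real K"
    unfolding g_def using assms K scale_mem[OF kernel_mem, of x]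
    by (simp add: ip_scale ip_scale_right kernel_mem ip_kernels)
  moreover have "ip (\<lambda>z. f z - g z) (\<lambda>z. f z - g z) = ip f f - ip f g - cnj (ip f g) + ip g g"
    using assms(1) g by (simp add: ip_diff ip_diff_right diff_mem ip_commute[of f g])
  moreover have "cnj t * f x = of_real ((cmod (f x))\<^sup>2 / K)"
    unfolding t_def using K(2) complex_norm_square[of "f x"] by (simp add: mult.commute)
  moreover have "t * cnj t * of_real K = of_real ((cmod (f x))\<^sup>2 / K)"
    unfolding t_def using K(2) complex_norm_square[of "f x"] by (simp add: field_simps)
  ultimately have "0 \<le> Re (ip f f) - (cmod (f x))\<^sup>2 / K"
    using ip_nonneg[OF diff_mem[OF assms(1) g]] by (simp del: of_real_power of_real_divide)
  then show ?thesis using K by (simp add: field_simps)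
qed

end

section \<open>The Pick property on finite sets of points\<close>

text \<open>The closed unit ball of the multiplier algebra; \<open>pick_scalar_mult\<close> extends
  a function satisfying \<open>kcontr\<close> on a finite set to a member of it.\<close>

definition contractive_mult ::
  "'x set \<Rightarrow> ('x \<Rightarrow> complex) set \<Rightarrow> (('x \<Rightarrow> complex) \<Rightarrow> ('x \<Rightarrow> complex) \<Rightarrow> complex) \<Rightarrow>
    ('x \<Rightarrow> complex) set" where
  "contractive_mult X H ip = {\<phi>. (\<forall>x. x \<notin> X \<longrightarrow> \<phi> x = 0) \<and>
    (\<forall>f\<in>H. (\<lambda>x. \<phi> x * f x) \<in> H \<and> ip_norm ip (\<lambda>x. \<phi> x * f x) \<le> ip_norm ip f)}"

lemma sum_swap3:
  fixes f :: "'a \<Rightarrow> 'b \<Rightarrow> 'c \<Rightarrow> 'd::comm_monoid_add"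
  shows "(\<Sum>x\<in>S. \<Sum>y\<in>T. \<Sum>r\<in>R. f x y r) = (\<Sum>r\<in>R. \<Sum>x\<in>S. \<Sum>y\<in>T. f x y r)"
proof -
  have "(\<Sum>x\<in>S. \<Sum>y\<in>T. \<Sum>r\<in>R. f x y r) = (\<Sum>x\<in>S. \<Sum>r\<in>R. \<Sum>y\<in>T. f x y r)"
    by (intro sum.cong refl sum.swap)
  also have "\<dots> = (\<Sum>r\<in>R. \<Sum>x\<in>S. \<Sum>y\<in>T. f x y r)"
    by (rule sum.swap)
  finally show ?thesis .
qed

text \<open>The Pick property speaks of square matrices, so a row of length \<open>n\<close> becomes
  the top row of a matrix that is zero elsewhere. Only coordinate 0 of the test vectors then meets
  the row; in the other coordinates the block form is that of the plain kernel.\<close>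

lemma row_padded_entry:
  fixes B D :: "nat \<Rightarrow> complex"
  assumes "n \<ge> 1" "u \<in> carrier_vec n" "v \<in> carrier_vec n"
  defines "W \<equiv> \<lambda>B. mat n n (\<lambda>(r, a). if r = 0 then B a else 0)"
  shows "((t \<cdot>\<^sub>m (1\<^sub>m n - W B * mat_adjoint (W D))) *\<^sub>v v) \<bullet>c u =
    (\<Sum>r<n. cnj (u $ r) * v $ r * t) - (\<Sum>a<n. cnj (u $ 0 * cnj (B a)) * (v $ 0 * cnj (D a)) * t)"
proof -
  have WW: "(W B * mat_adjoint (W D)) $$ (r, s) =
      (if r = 0 \<and> s = 0 then \<Sum>a<n. B a * cnj (D a) else 0)" if "r < n" "s < n" for r s
    using that unfolding W_def
    by (auto simp: mat_adjoint_def scalar_prod_def atLeast0LessThan mat_of_rows_index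
        intro!: sum.cong)
  have dim: "W B * mat_adjoint (W D) \<in> carrier_mat n n"
    unfolding W_def mat_adjoint_def by auto
  define b where "b = (\<Sum>a<n. B a * cnj (D a))"
  define M where "M = W B * mat_adjoint (W D)"
  have M: "M \<in> carrier_mat n n" unfolding M_def by (rule dim)
  have M_entry: "M $$ (r, s) = (if r = 0 \<and> s = 0 then b else 0)" if "r < n" "s < n" for r s
    unfolding M_def b_def using WW[OF that] .
  have row: "((t \<cdot>\<^sub>m (1\<^sub>m n - M)) *\<^sub>v v) $ r =
      t * v $ r - (if r = 0 then t * b * v $ 0 else 0)" if "r < n" for r
  proof -
    have "((t \<cdot>\<^sub>m (1\<^sub>m n - M)) *\<^sub>v v) $ r =
        (\<Sum>s<n. (t * ((if r = s then 1 else 0) - (if r = 0 \<and> s = 0 then b else 0))) * v $ s)"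
      using that assms(3) M
      by (auto simp: scalar_prod_def atLeast0LessThan M_entry intro!: sum.cong)
    also have "\<dots> = (\<Sum>s<n. (if r = s then t * v $ s else 0) -
        (if s = 0 then (if r = 0 then t * b * v $ 0 else 0) else 0))"
      by (intro sum.cong) (auto simp: algebra_simps)
    also have "\<dots> = t * v $ r - (if r = 0 then t * b * v $ 0 else 0)"
      using that assms(1) by (simp add: sum_subtractf)
    finally show ?thesis .
  qed
  define z where "z = (t \<cdot>\<^sub>m (1\<^sub>m n - M)) *\<^sub>v v"
  have z: "z \<in> carrier_vec n" "\<And>r. r < n \<Longrightarrow> z $ r = t * v $ r - (if r = 0 then t * b * v $ 0 else 0)"
    subgoal unfolding z_def using M assms(3) by (intro mult_mat_vec_carrier) auto
    subgoal unfolding z_def by (rule row)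
    done
  have "((t \<cdot>\<^sub>m (1\<^sub>m n - W B * mat_adjoint (W D))) *\<^sub>v v) \<bullet>c u =
      (\<Sum>r<n. (t * v $ r - (if r = 0 then t * b * v $ 0 else 0)) * cnj (u $ r))"
    using assms(2) z(1) unfolding M_def[symmetric] z_def[symmetric]
    by (auto simp: scalar_prod_def z(2) atLeast0LessThan intro!: sum.cong)
  also have "\<dots> = (\<Sum>r<n. cnj (u $ r) * v $ r * t -
      (if r = 0 then t * b * v $ 0 * cnj (u $ 0) else 0))"
    by (intro sum.cong) (auto simp: algebra_simps)
  also have "\<dots> = (\<Sum>r<n. cnj (u $ r) * v $ r * t) - t * b * v $ 0 * cnj (u $ 0)"
    using assms(1) by (simp add: sum_subtractf)
  also have "t * b * v $ 0 * cnj (u $ 0) = (\<Sum>a<n. cnj (u $ 0 * cnj (B a)) * (v $ 0 * cnj (D a)) * t)"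
    unfolding b_def sum_distrib_left sum_distrib_right by (intro sum.cong) (auto simp: algebra_simps)
  finally show ?thesis .
qed

section \<open>The Pick property for rows and for scalars\<close>

context rkhs
begin

lemma ip_norm_nonneg: "f \<in> H \<Longrightarrow> 0 \<le> ip_norm ip f"
  by (simp add: ip_norm_def ip_nonneg)

lemma kernel_sum_eq_ksq:
  assumes "finite S" "S \<subseteq> X"
  shows "(\<Sum>x\<in>S. \<Sum>y\<in>S. cnj (c x) * c y * k x y) = of_real (ksq k S c)"
  using kernel_sum_Im[OF assms, of c] unfolding ksq_def by (simp add: complex_eq_iff)

text \<open>Let \<open>F\<close> be the image of \<open>h\<close> under the adjoint of the row, and
  \<open>u\<close> the row applied to \<open>F\<close>. The inner product of \<open>u\<close> and
  \<open>h\<close> is the squared norm \<open>N\<close> of \<open>F\<close>, and the squared norm of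
  \<open>u\<close> is at most \<open>N\<close>. Expanding the squared norm of \<open>u - h\<close>
  then gives \<open>N \<le> Re (ip h h)\<close>.\<close>

lemma contractive_multiplier_row:
  assumes \<Phi>: "contractive_multiplier X H ip n \<Phi>" and n: "n \<ge> 1" and T: "finite T" "T \<subseteq> X"
  shows "row_contr k T n (\<lambda>x a. \<Phi> x $$ (0, a))"
  unfolding row_contr_def
proof
  fix c
  define G where "G = (\<lambda>a. kcomb k T (\<lambda>x. c x * cnj (\<Phi> x $$ (0, a))))"
  define F where "F = (\<lambda>x. vec n (\<lambda>a. G a x))"
  define u where "u = (\<lambda>x. (\<Phi> x *\<^sub>v F x) $ 0)"
  define h where "h = kcomb k T c"
  define N where "N = (\<Sum>a<n. ksq k T (\<lambda>x. c x * cnj (\<Phi> x $$ (0, a))))"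
  have G: "G a \<in> H" for a unfolding G_def using T by (rule kcomb_mem)
  have h: "h \<in> H" unfolding h_def using T by (rule kcomb_mem)
  have ksqG: "ksq k T (\<lambda>x. c x * cnj (\<Phi> x $$ (0, a))) = Re (ip (G a) (G a))" for a
    unfolding G_def using T by (rule ksq_eq_ip)
  have F: "F \<in> tensor_space H n" unfolding tensor_space_def F_def using G by auto
  have \<Phi>F: "(\<lambda>x. \<Phi> x *\<^sub>v F x) \<in> tensor_space H n"
    "tensor_norm ip n (\<lambda>x. \<Phi> x *\<^sub>v F x) \<le> tensor_norm ip n F"
    and \<Phi>_carrier: "\<Phi> x \<in> carrier_mat n n" for x
    using \<Phi> F unfolding contractive_multiplier_def by auto
  have u: "u \<in> H" using \<Phi>F(1) n unfolding tensor_space_def u_def by auto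
  have u_eq: "u x = (\<Sum>a<n. \<Phi> x $$ (0, a) * G a x)" for x
    using n \<Phi>_carrier[of x] unfolding u_def F_def
    by (auto simp: scalar_prod_def atLeast0LessThan intro!: sum.cong)
  have "ip u h = (\<Sum>y\<in>T. cnj (c y) * u y)"
    unfolding h_def using T u by (rule ip_kcomb)
  also have "\<dots> = (\<Sum>a<n. \<Sum>y\<in>T. cnj (c y * cnj (\<Phi> y $$ (0, a))) * G a y)"
    unfolding u_eq sum_distrib_left by (subst sum.swap) (simp add: mult.assoc)
  also have "\<dots> = (\<Sum>a<n. ip (G a) (G a))"
    by (intro sum.cong refl, subst (2) G_def) (simp add: ip_kcomb[OF T G])
  finally have uh: "Re (ip u h) = N" unfolding N_def ksqG by simp
  have nF: "tensor_norm ip n F = sqrt N"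
    unfolding tensor_norm_def N_def ksqG F_def by (simp add: ip_norm_sq[OF G])
  have "(ip_norm ip u)\<^sup>2 \<le> (\<Sum>a<n. (ip_norm ip (\<lambda>x. (\<Phi> x *\<^sub>v F x) $ a))\<^sup>2)"
    unfolding u_def using n by (intro member_le_sum) auto
  also have "\<dots> \<le> N"
    using \<Phi>F(2) unfolding nF by (simp add: tensor_norm_def)
  finally have uu: "Re (ip u u) \<le> N" by (simp add: ip_norm_sq u)
  have "ip (\<lambda>x. u x - h x) (\<lambda>x. u x - h x) = ip u u - ip u h - cnj (ip u h) + ip h h"
    using u h by (simp add: ip_diff ip_diff_right diff_mem ip_commute[of u h])
  then have "0 \<le> Re (ip u u) - 2 * Re (ip u h) + Re (ip h h)"
    using ip_nonneg[OF diff_mem[OF u h]] by simp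
  then have "N \<le> Re (ip h h)" using uh uu by simp
  then show "(\<Sum>a<n. ksq k T (\<lambda>x. c x * cnj (\<Phi> x $$ (0, a)))) \<le> ksq k T c"
    unfolding N_def h_def ksq_eq_ip[OF T] .
qed

lemma pick_row_multiplier:
  assumes pick: "complete_pick X H ip k" and S: "finite S" "S \<subseteq> X" and n: "n \<ge> 1"
    and B: "row_contr k S n B"
  obtains \<Phi> where "contractive_multiplier X H ip n \<Phi>"
    "\<And>x a. x \<in> S \<Longrightarrow> a < n \<Longrightarrow> \<Phi> x $$ (0, a) = B x a"
proof -
  obtain p where "bij_betw p {0..<card S} S" using ex_bij_betw_nat_finite[OF S(1)] by blast
  define N where "N = card S"
  have p: "bij_betw p {..<N} S"
    using \<open>bij_betw p {0..<card S} S\<close> by (simp add: N_def atLeast0LessThan)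
  define q where "q = inv_into {..<N} p"
  have pS: "p i \<in> S" and qp: "q (p i) = i" if "i < N" for i
    using p that by (auto simp: q_def bij_betw_def)
  define W where "W = (\<lambda>x. mat n n (\<lambda>(r, a). if r = 0 then B x a else 0))"
  have W: "W x = mat n n (\<lambda>(r, a). if r = 0 then B x a else 0)" for x unfolding W_def ..
  have "block_psd N n (\<lambda>i j. k (p i) (p j) \<cdot>\<^sub>m (1\<^sub>m n - W (p i) * mat_adjoint (W (p j))))"
    unfolding block_psd_def
  proof (intro allI impI)
    fix v :: "nat \<Rightarrow> complex vec"
    assume v: "\<forall>i<N. v i \<in> carrier_vec n"
    \<comment> \<open>\<open>c r\<close> collects the \<open>r\<close>-th coordinates of the test
      vector, indexed by points instead of positions. The coordinates other than 0 contribute values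
      of \<open>ksq\<close>, hence nonnegative terms.\<close>
    define c where "c = (\<lambda>r x. v (q x) $ r)"
    let ?t = "\<lambda>x y. (\<Sum>r<n. cnj (c r x) * c r y * k x y) -
        (\<Sum>a<n. cnj (c 0 x * cnj (B x a)) * (c 0 y * cnj (B y a)) * k x y)"
    have entry: "((k (p i) (p j) \<cdot>\<^sub>m (1\<^sub>m n - W (p i) * mat_adjoint (W (p j)))) *\<^sub>v v j) \<bullet>c v i
      = ?t (p i) (p j)" if "i < N" "j < N" for i j
      using v that unfolding W_def c_def qp[OF that(1)] qp[OF that(2)]
      by (intro row_padded_entry n) auto
    have "(\<Sum>i<N. \<Sum>j<N. ((k (p i) (p j) \<cdot>\<^sub>m (1\<^sub>m n - W (p i) * mat_adjoint (W (p j)))) *\<^sub>v v j) \<bullet>c v i)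
      = (\<Sum>i<N. \<Sum>j<N. ?t (p i) (p j))"
      using entry by (intro sum.cong refl) auto
    also have "\<dots> = (\<Sum>i<N. \<Sum>y\<in>S. ?t (p i) y)"
      by (intro sum.cong refl sum.reindex_bij_betw[OF p])
    also have "\<dots> = (\<Sum>x\<in>S. \<Sum>y\<in>S. ?t x y)"
      by (rule sum.reindex_bij_betw[OF p])
    also have "\<dots> = (\<Sum>r<n. \<Sum>x\<in>S. \<Sum>y\<in>S. cnj (c r x) * c r y * k x y) -
        (\<Sum>a<n. \<Sum>x\<in>S. \<Sum>y\<in>S. cnj (c 0 x * cnj (B x a)) * (c 0 y * cnj (B y a)) * k x y)"
      by (simp only: sum_subtractf sum_swap3[where R="{..<n}" and S=S and T=S])
    also have "\<dots> = of_real ((\<Sum>r<n. ksq k S (c r)) - (\<Sum>a<n. ksq k S (\<lambda>x. c 0 x * cnj (B x a))))"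
      by (simp only: kernel_sum_eq_ksq[OF S] of_real_diff of_real_sum)
    finally have eq: "(\<Sum>i<N. \<Sum>j<N. ((k (p i) (p j) \<cdot>\<^sub>m (1\<^sub>m n - W (p i) * mat_adjoint (W (p j)))) *\<^sub>v v j) \<bullet>c v i)
      = of_real ((\<Sum>r<n. ksq k S (c r)) - (\<Sum>a<n. ksq k S (\<lambda>x. c 0 x * cnj (B x a))))" .
    have "(\<Sum>a<n. ksq k S (\<lambda>x. c 0 x * cnj (B x a))) \<le> ksq k S (c 0)"
      using B unfolding row_contr_def by (rule spec)
    also have "\<dots> \<le> (\<Sum>r<n. ksq k S (c r))"
      using n by (intro member_le_sum[of 0 _ "\<lambda>r. ksq k S (c r)"] ksq_nonneg S) auto
    finally show "0 \<le> (\<Sum>i<N. \<Sum>j<N. ((k (p i) (p j) \<cdot>\<^sub>m (1\<^sub>m n - W (p i) * mat_adjoint (W (p j)))) *\<^sub>v v j) \<bullet>c v i)"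
      unfolding eq by (simp only: less_eq_complex_def) simp
  qed
  moreover have "inj_on p {..<N}" "\<forall>i<N. p i \<in> X" "\<forall>i<N. W (p i) \<in> carrier_mat n n"
    using p S pS by (auto simp: bij_betw_def W)
  ultimately obtain \<Phi> where \<Phi>: "contractive_multiplier X H ip n \<Phi>" "\<forall>i<N. \<Phi> (p i) = W (p i)"
    using pick[unfolded complete_pick_def, rule_format, of n p N "\<lambda>i. W (p i)"] n by auto
  have "\<Phi> x $$ (0, a) = B x a" if x: "x \<in> S" and a: "a < n" for x a
  proof -
    obtain i where "i < N" "x = p i" using p x by (auto simp: bij_betw_def)
    then show ?thesis using \<Phi>(2) a n by (simp add: W)
  qed
  then show thesis using that \<Phi>(1) by blast
qed

text \<open>What is gained over \<open>B\<close> is contractivity on every finite \<open>T\<close>,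
  so that new points can be adjoined to \<open>S\<close>.\<close>

lemma pick_row:
  assumes "complete_pick X H ip k" "finite S" "S \<subseteq> X" "n \<ge> 1" "row_contr k S n B"
  obtains D where "\<And>x a. x \<in> S \<Longrightarrow> a < n \<Longrightarrow> D x a = B x a"
    "\<And>T. finite T \<Longrightarrow> T \<subseteq> X \<Longrightarrow> row_contr k T n D"
proof -
  obtain \<Phi> where \<Phi>: "contractive_multiplier X H ip n \<Phi>"
    "\<And>x a. x \<in> S \<Longrightarrow> a < n \<Longrightarrow> \<Phi> x $$ (0, a) = B x a"
    using pick_row_multiplier[OF assms] by blast
  show thesis
    using \<Phi>(2) contractive_multiplier_row[OF \<Phi>(1) assms(4)]
    by (rule that[of "\<lambda>x a. \<Phi> x $$ (0, a)"])
qed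

lemma pick_scalar_mult:
  assumes "complete_pick X H ip k" "finite S" "S \<subseteq> X" "kcontr k S \<phi>"
  obtains \<psi> where "\<psi> \<in> contractive_mult X H ip" "\<And>x. x \<in> S \<Longrightarrow> \<psi> x = \<phi> x"
proof -
  have "row_contr k S 1 (\<lambda>x a. \<phi> x)" using assms(4) by (simp only: row_contr_1)
  then obtain \<Phi> where \<Phi>: "contractive_multiplier X H ip 1 \<Phi>"
    "\<And>x a. x \<in> S \<Longrightarrow> a < 1 \<Longrightarrow> \<Phi> x $$ (0, a) = \<phi> x"
    using pick_row_multiplier[OF assms(1-3) order_refl] by metis
  define \<psi> where "\<psi> = (\<lambda>x. \<Phi> x $$ (0, 0))"
  have "\<psi> x = 0" if "x \<notin> X" for x
    using \<Phi>(1) that unfolding contractive_multiplier_def \<psi>_def by auto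
  moreover have "(\<lambda>x. \<psi> x * f x) \<in> H \<and> ip_norm ip (\<lambda>x. \<psi> x * f x) \<le> ip_norm ip f" if f: "f \<in> H" for f
  proof -
    define F where "F = (\<lambda>x. vec 1 (\<lambda>a::nat. f x))"
    have "F \<in> tensor_space H 1" using f by (simp add: tensor_space_def F_def)
    then have F: "(\<lambda>x. \<Phi> x *\<^sub>v F x) \<in> tensor_space H 1"
      "tensor_norm ip 1 (\<lambda>x. \<Phi> x *\<^sub>v F x) \<le> tensor_norm ip 1 F"
      and \<Phi>_carrier: "\<And>x. \<Phi> x \<in> carrier_mat 1 1"
      using \<Phi>(1) unfolding contractive_multiplier_def by auto
    have "(\<Phi> x *\<^sub>v F x) $ 0 = \<psi> x * f x" for x
      using \<Phi>_carrier[of x] by (auto simp: F_def \<psi>_def scalar_prod_def)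
    then show ?thesis
      using F f by (auto simp: tensor_space_def tensor_norm_def F_def abs_of_nonneg ip_norm_nonneg)
  qed
  ultimately have "\<psi> \<in> contractive_mult X H ip" unfolding contractive_mult_def by blast
  then show thesis using that \<Phi>(2) unfolding \<psi>_def by auto
qed

lemma pick_scalar:
  assumes "complete_pick X H ip k" "finite S" "S \<subseteq> X" "kcontr k S \<phi>"
  obtains \<psi> where "\<And>x. x \<in> S \<Longrightarrow> \<psi> x = \<phi> x"
    "\<And>T. finite T \<Longrightarrow> T \<subseteq> X \<Longrightarrow> kcontr k T \<psi>"
proof -
  have "row_contr k S 1 (\<lambda>x a. \<phi> x)" using assms(4) by (simp only: row_contr_1)
  then obtain D where "\<And>x a. x \<in> S \<Longrightarrow> a < 1 \<Longrightarrow> D x a = \<phi> x"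
    "\<And>T. finite T \<Longrightarrow> T \<subseteq> X \<Longrightarrow> row_contr k T 1 D"
    using pick_row[OF assms(1-3) order_refl] by metis
  then show thesis using that[of "\<lambda>x. D x 0"] by (simp only: row_contr_1)
qed

end

section \<open>The McCullough--Quiggin condition\<close>

text \<open>A real-affine function of \<open>s\<close> that is bounded below is constant: for
  \<open>a \<noteq> 0\<close> the chosen \<open>s\<close> gives the right-hand side the value
  -1.\<close>

lemma cross_term_eq_zero:
  assumes "\<And>s::complex. 0 \<le> r + 2 * Re (s * a)"
  shows "a = 0"
proof (rule ccontr)
  assume a: "a \<noteq> 0"
  define A where "A = (cmod a)\<^sup>2"
  have A: "A > 0" using a by (simp add: A_def)
  define s where "s = of_real (- (r + 1) / (2 * A)) * cnj a"
  have "s * a = of_real (- (r + 1) / (2 * A)) * (a * cnj a)"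
    unfolding s_def by simp
  also have "a * cnj a = of_real A" unfolding A_def by (rule complex_norm_square[symmetric])
  finally have "s * a = of_real (- (r + 1) / (2 * A) * A)" by (simp only: of_real_mult)
  then have "Re (s * a) = - (r + 1) / (2 * A) * A" by (simp only: Re_complex_of_real)
  then have "Re (s * a) = - (r + 1) / 2" using A by simp
  then show False using assms[of s] by simp
qed

context rkhs
begin

text \<open>The matrix is the Gram matrix of the projections of the kernel functions onto the line
  spanned by the one at \<open>w\<close>, so its form is the squared modulus of a single linear
  functional. This is the standard source of positivity below.\<close>

lemma rank_one_form:
  assumes "S \<subseteq> X" "w \<in> X"
  shows "(\<Sum>x\<in>S. \<Sum>z\<in>S. cnj (c x) * c z * (k x w * k w z / k w w)) =
    of_real ((cmod (\<Sum>z\<in>S. c z * k w z))\<^sup>2 / Re (k w w))"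
proof -
  define m where "m = (\<Sum>z\<in>S. c z * k w z)"
  have "cnj m = (\<Sum>x\<in>S. cnj (c x) * k x w)"
    unfolding m_def cnj_sum using assms kernel_hermitian[of w]
    by (intro sum.cong) auto
  then have "cnj m * m = (\<Sum>x\<in>S. \<Sum>z\<in>S. (cnj (c x) * k x w) * (c z * k w z))"
    unfolding m_def by (simp only: sum_product)
  then have "cnj m * m / k w w = (\<Sum>x\<in>S. \<Sum>z\<in>S. cnj (c x) * c z * (k x w * k w z / k w w))"
    by (simp add: sum_divide_distrib mult_ac)
  moreover have "cnj m * m = of_real ((cmod m)\<^sup>2)"
    using complex_norm_square[of m] by (simp add: mult.commute)
  ultimately show ?thesis
    using kernel_diag_real[OF assms(2)] unfolding m_def[symmetric] by simp
qed

text \<open>The Pick matrix of \<open>\<psi>\<close> on the two points is positive and its diagonal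
  entry at \<open>x\<close> vanishes, so its off-diagonal entry vanishes too; an arbitrary weight
  \<open>s\<close> at \<open>x\<close> detects this.\<close>

lemma kcontr_unimodular:
  assumes xy: "x \<in> X" "y \<in> X" "x \<noteq> y" and \<psi>: "kcontr k {x, y} \<psi>"
    and "\<psi> x * cnj (\<psi> x) = 1" "k x y \<noteq> 0"
  shows "\<psi> x * cnj (\<psi> y) = 1"
proof -
  define a where "a = k x y * (1 - \<psi> x * cnj (\<psi> y))"
  define r where "r = Re (k y y * (1 - \<psi> y * cnj (\<psi> y)))"
  have "0 \<le> r + 2 * Re (s * a)" for s
  proof -
    define c where "c = (\<lambda>u. if u = x then cnj s else 1)"
    have "0 \<le> ksq k {x, y} c - ksq k {x, y} (\<lambda>u. c u * cnj (\<psi> u))"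
      using \<psi> unfolding kcontr_def by simp
    also have "\<dots> = Re (s * a + cnj (s * a) + k y y * (1 - \<psi> y * cnj (\<psi> y)))"
      unfolding kcontr_eq
    proof (rule arg_cong[where f = Re])
      have "(\<Sum>u\<in>{x, y}. \<Sum>v\<in>{x, y}. cnj (c u) * c v * (k u v * (1 - \<psi> u * cnj (\<psi> v)))) =
        s * cnj s * (k x x * (1 - \<psi> x * cnj (\<psi> x))) + s * a
        + cnj s * (k y x * (1 - \<psi> y * cnj (\<psi> x))) + k y y * (1 - \<psi> y * cnj (\<psi> y))"
        using xy(3) by (simp add: c_def a_def)
      then show "(\<Sum>u\<in>{x, y}. \<Sum>v\<in>{x, y}. cnj (c u) * c v * (k u v * (1 - \<psi> u * cnj (\<psi> v)))) =
        s * a + cnj (s * a) + k y y * (1 - \<psi> y * cnj (\<psi> y))"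
        unfolding assms(5) a_def using kernel_hermitian[OF xy(1,2)] by (simp add: mult.commute)
    qed
    finally show ?thesis unfolding r_def plus_complex.sel(1) cnj.sel(1) by linarith
  qed
  then have "a = 0" by (rule cross_term_eq_zero)
  then show ?thesis using assms(6) by (simp add: a_def)
qed

text \<open>Otherwise a contractive multiplier takes the values \<open>1\<close> at \<open>x\<close> and \<open>-1\<close> at \<open>z\<close>, and each of
  these values propagates to \<open>y\<close>.\<close>

lemma pick_kernel_zero:
  assumes pick: "complete_pick X H ip k" and diag: "\<forall>z\<in>X. k z z \<noteq> 0"
    and xyz: "x \<in> X" "y \<in> X" "z \<in> X" and zero: "k x z = 0"
  shows "k x y = 0 \<or> k y z = 0"
proof (rule ccontr)
  assume "\<not> ?thesis"
  then have nz: "k x y \<noteq> 0" "k z y \<noteq> 0" using kernel_hermitian[of y z] xyz by auto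
  have xz: "x \<noteq> z" "k z x = 0" using zero diag xyz kernel_hermitian[of x z] by auto
  have "kcontr k {x, z} (\<lambda>u. if u = x then 1 else - 1)"
    unfolding kcontr_def
  proof
    fix c
    have "ksq k {x, z} c - ksq k {x, z} (\<lambda>u. c u * cnj (if u = x then 1 else - 1)) = 0"
      unfolding kcontr_eq using xz zero by simp
    then show "ksq k {x, z} (\<lambda>u. c u * cnj (if u = x then 1 else - 1)) \<le> ksq k {x, z} c" by simp
  qed
  then obtain \<psi> where \<psi>: "\<And>u. u \<in> {x, z} \<Longrightarrow> \<psi> u = (if u = x then 1 else - 1)"
    "\<And>T. finite T \<Longrightarrow> T \<subseteq> X \<Longrightarrow> kcontr k T \<psi>"
    using pick_scalar[OF pick, of "{x, z}"] xyz by blast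
  have "x \<noteq> y" "z \<noteq> y" using nz xz zero by auto
  then have "\<psi> x * cnj (\<psi> y) = 1" "\<psi> z * cnj (\<psi> y) = 1"
    using kcontr_unimodular[of x y \<psi>] kcontr_unimodular[of z y \<psi>] \<psi> nz xyz xz(1) by auto
  then show False using \<psi>(1)[of x] \<psi>(1)[of z] xz(1) by (simp add: complex_eq_iff)
qed

text \<open>By \<open>pick_kernel_zero\<close>, having a nonzero kernel value is a transitive
  relation between points. The points related to \<open>z\<close> and the remaining ones would
  therefore split \<open>X\<close> into two orthogonal parts.\<close>

lemma pick_kernel_nonvanishing:
  assumes pick: "complete_pick X H ip k" and diag: "\<forall>z\<in>X. k z z \<noteq> 0"
    and irr: "irreducible_kernel X k" and xz: "x \<in> X" "z \<in> X"
  shows "k x z \<noteq> 0"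
proof
  assume zero: "k x z = 0"
  define X1 where "X1 = {u \<in> X. k u z \<noteq> 0}"
  define X2 where "X2 = {u \<in> X. k u z = 0}"
  have "k u v = 0" if "u \<in> X1" "v \<in> X2" for u v
    using pick_kernel_zero[OF pick diag, of v u z] kernel_hermitian[of v u] that xz
    unfolding X1_def X2_def by auto
  moreover have "X1 \<union> X2 = X" "X1 \<inter> X2 = {}" "z \<in> X1" "x \<in> X2"
    using xz zero diag unfolding X1_def X2_def by auto
  ultimately show False using irr unfolding irreducible_kernel_def by blast
qed

text \<open>A Schwarz lemma. The coefficients \<open>c\<close> describe the component of the kernel
  function at \<open>x\<close> orthogonal to the one at \<open>y\<close>; the Pick form there is the
  Schur complement obtained by eliminating \<open>y\<close>.\<close>

lemma row_contr_vanishing_bound: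
  assumes D: "row_contr k {x, y} n D" and xy: "x \<in> X" "y \<in> X" "x \<noteq> y" "k y y \<noteq> 0" "k x x \<noteq> 0"
    and vanish: "\<And>a. a < n \<Longrightarrow> D y a = 0"
  shows "Re (\<Sum>a<n. D x a * cnj (D x a)) \<le> Re (1 - k x y * k y x / (k y y * k x x))"
proof -
  define c where "c = (\<lambda>u. if u = x then 1 else - k y x / k y y)"
  define d where "d = (\<Sum>a<n. D x a * cnj (D x a))"
  have K: "cnj (k y y) = k y y" "cnj (k y x) = k x y"
    using kernel_hermitian[of y y] kernel_hermitian[of y x] xy by auto
  have "0 \<le> ksq k {x, y} c - (\<Sum>a<n. ksq k {x, y} (\<lambda>u. c u * cnj (D u a)))"
    using D unfolding row_contr_def by simp
  also have "\<dots> = Re (k x x * (1 - d) - k x y * k y x / k y y)"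
    unfolding row_contr_eq using xy vanish K by (simp add: c_def d_def field_simps)
  also have "k x x * (1 - d) - k x y * k y x / k y y =
      of_real (Re (k x x)) * (1 - k x y * k y x / (k y y * k x x) - d)"
    unfolding kernel_diag_real[OF xy(1), symmetric] using xy by (simp add: field_simps)
  finally have "0 \<le> Re (k x x) * Re (1 - k x y * k y x / (k y y * k x x) - d)" by simp
  then show ?thesis
    unfolding d_def[symmetric] using kernel_diag_pos[OF xy(1,5)] by (simp add: zero_le_mult_iff)
qed

text \<open>Eliminating \<open>y\<close> leaves a positive form on \<open>x\<close> and
  \<open>z\<close> whose diagonal entry at \<open>z\<close> vanishes by the last assumption. Its
  off-diagonal entry \<open>p\<close> must then vanish, which is the asserted value.\<close>

lemma row_contr_forced_entry:
  assumes D: "row_contr k {x, z, y} n D" and xzy: "x \<in> X" "z \<in> X" "y \<in> X" "x \<noteq> z" "x \<noteq> y" "z \<noteq> y"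
    and nz: "k y y \<noteq> 0" "k x z \<noteq> 0" "k z z \<noteq> 0"
    and vanish: "\<And>a. a < n \<Longrightarrow> D y a = 0"
    and z: "(\<Sum>a<n. D z a * cnj (D z a)) = 1 - k z y * k y z / (k y y * k z z)"
  shows "(\<Sum>a<n. D x a * cnj (D z a)) = 1 - k x y * k y z / (k y y * k x z)"
proof -
  define d where "d = (\<Sum>a<n. D x a * cnj (D x a))"
  define e where "e = (\<Sum>a<n. D x a * cnj (D z a))"
  define r where "r = Re (k x x * (1 - d) - k x y * k y x / k y y)"
  define p where "p = k x z * (1 - e) - k x y * k y z / k y y"
  have e': "(\<Sum>a<n. D z a * cnj (D x a)) = cnj e"
    unfolding e_def by (simp add: mult.commute)
  have K: "cnj (k y y) = k y y" "cnj (k y x) = k x y" "cnj (k y z) = k z y"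
    "cnj (k x y) = k y x" "cnj (k z y) = k y z" "cnj (k x z) = k z x"
    using xzy kernel_hermitian[of y y] kernel_hermitian[of y x] kernel_hermitian[of y z]
      kernel_hermitian[of x y] kernel_hermitian[of z y] kernel_hermitian[of x z] by auto
  have "0 \<le> r + 2 * Re (s * p)" for s
  proof -
    \<comment> \<open>The weight at \<open>y\<close> makes \<open>kcomb k {x, z, y} c\<close> vanish
      at \<open>y\<close>, which removes \<open>y\<close> from the form.\<close>
    define c where "c = (\<lambda>u. if u = x then 1 else if u = z then s else - (k y x + s * k y z) / k y y)"
    have "0 \<le> ksq k {x, z, y} c - (\<Sum>a<n. ksq k {x, z, y} (\<lambda>u. c u * cnj (D u a)))"
      using D unfolding row_contr_def by simp
    also have "\<dots> = Re ((k x x * (1 - d) - k x y * k y x / k y y) + s * p + cnj (s * p))"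
      unfolding row_contr_eq
    proof (rule arg_cong[where f = Re])
      have 1: "(\<Sum>u\<in>{x, z, y}. \<Sum>v\<in>{x, z, y}. cnj (c u) * c v * (k u v * (1 - (\<Sum>a<n. D u a * cnj (D v a))))) =
        k x x * (1 - d) + s * (k x z * (1 - e)) + c y * k x y
        + cnj s * (k z x * (1 - cnj e)) + cnj s * s * (k z y * k y z / k y y) + cnj s * c y * k z y
        + cnj (c y) * k y x + cnj (c y) * s * k y z + cnj (c y) * c y * k y y"
        using xzy vanish z nz by (simp add: c_def d_def[symmetric] e_def[symmetric] e')
      show "(\<Sum>u\<in>{x, z, y}. \<Sum>v\<in>{x, z, y}. cnj (c u) * c v * (k u v * (1 - (\<Sum>a<n. D u a * cnj (D v a))))) =
        (k x x * (1 - d) - k x y * k y x / k y y) + s * p + cnj (s * p)"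
        unfolding 1 using xzy K nz by (simp add: c_def p_def field_simps)
    qed
    finally show ?thesis unfolding r_def plus_complex.sel(1) cnj.sel(1) by linarith
  qed
  then have "p = 0" by (rule cross_term_eq_zero)
  then show ?thesis using nz unfolding p_def e_def[symmetric] by (simp add: field_simps)
qed

text \<open>On \<open>insert y T\<close> the Gram vectors \<open>B\<close> found so far satisfy
  \<open>k (1 - B B\<^sup>*) = k\<^sub>y k\<^sub>y\<^sup>* / k y y\<close>, which has rank one; a contractive extension of the row \<open>B\<close> to
  a new point is therefore forced to have the right inner products with the old vectors, and one
  further coordinate corrects its length.\<close>

lemma pick_gram_vectors:
  assumes pick: "complete_pick X H ip k" and nonzero: "\<forall>x\<in>X. \<forall>z\<in>X. k x z \<noteq> 0"
    and y: "y \<in> X" and T: "finite T" "T \<subseteq> X"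
  shows "\<exists>n B. n \<ge> (1::nat) \<and> (\<forall>x\<in>insert y T. \<forall>z\<in>insert y T.
    (\<Sum>a<n. B x a * cnj (B z a)) = 1 - k x y * k y z / (k y y * k x z))"
  using T
proof (induction T rule: finite_induct)
  case empty
  show ?case
    \<comment> \<open>At the single point \<open>y\<close> the required value is 0. The zero vector
      is given length 1 because the Pick property asks for \<open>n \<ge> 1\<close>.\<close>
    by (intro exI[of _ 1] exI[of _ "\<lambda>x a. 0"]) (use nonzero y in simp)
next
  case (insert w T)
  note nv = nonzero[rule_format]
  define F where "F = (\<lambda>x z. 1 - k x y * k y z / (k y y * k x z))"
  define S where "S = insert y T"
  have S: "finite S" "S \<subseteq> X" "y \<in> S" and wX: "w \<in> X"
    using insert y by (auto simp: S_def)
  obtain n B where n: "n \<ge> (1::nat)"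
    and B: "\<And>x z. x \<in> S \<Longrightarrow> z \<in> S \<Longrightarrow> (\<Sum>a<n. B x a * cnj (B z a)) = F x z"
    using insert.IH insert.prems unfolding S_def F_def by blast
  show ?case
  proof (cases "w \<in> S")
    case True
    then have "insert y (insert w T) = S" unfolding S_def by auto
    then show ?thesis using n B unfolding F_def by auto
  next
    case False
    have "row_contr k S n B"
      unfolding row_contr_def
    proof
      fix c
      have "ksq k S c - (\<Sum>a<n. ksq k S (\<lambda>x. c x * cnj (B x a))) =
          Re (\<Sum>x\<in>S. \<Sum>z\<in>S. cnj (c x) * c z * (k x y * k y z / k y y))"
        unfolding row_contr_eq using B nv S(2) y
        by (intro arg_cong[where f = Re] sum.cong refl) (auto simp: F_def subset_iff)
      also have "\<dots> = (cmod (\<Sum>z\<in>S. c z * k y z))\<^sup>2 / Re (k y y)"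
        unfolding rank_one_form[OF S(2) y] by (rule Re_complex_of_real)
      also have "\<dots> \<ge> 0" using kernel_diag_pos[OF y nv[OF y y]] by simp
      finally show "(\<Sum>a<n. ksq k S (\<lambda>x. c x * cnj (B x a))) \<le> ksq k S c" by simp
    qed
    then obtain D where D: "\<And>x a. x \<in> S \<Longrightarrow> a < n \<Longrightarrow> D x a = B x a"
      and DT: "\<And>T. finite T \<Longrightarrow> T \<subseteq> X \<Longrightarrow> row_contr k T n D"
      using pick_row[OF pick S(1,2) n] by blast
    have DS: "(\<Sum>a<n. D x a * cnj (D z a)) = F x z" if "x \<in> S" "z \<in> S" for x z
      using B[OF that] D that by simp
    have Dy: "D y a = 0" if "a < n" for a
    proof -
      have "of_real (\<Sum>a<n. (cmod (D y a))\<^sup>2) = (\<Sum>a<n. D y a * cnj (D y a))"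
        unfolding of_real_sum complex_norm_square ..
      also have "\<dots> = of_real 0" using DS[OF S(3) S(3)] nv[OF y y] by (simp add: F_def)
      finally have "(\<Sum>a<n. (cmod (D y a))\<^sup>2) = 0" by (simp only: of_real_eq_iff)
      then show ?thesis using that by (simp add: sum_nonneg_eq_0_iff)
    qed
    have wy: "w \<noteq> y" using False S(3) by blast
    define d where "d = Re (\<Sum>a<n. D w a * cnj (D w a))"
    have d: "(\<Sum>a<n. D w a * cnj (D w a)) = of_real d"
      unfolding d_def complex_norm_square[symmetric] of_real_sum[symmetric] Re_complex_of_real ..
    have dF: "d \<le> Re (F w w)"
      unfolding d_def F_def
      using DT[of "{w, y}"] wX y wy nv Dy by (intro row_contr_vanishing_bound) auto
    have Fww: "F w w = of_real (Re (F w w))"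
      unfolding F_def using kernel_hermitian[OF wX y] kernel_diag_real[OF y] kernel_diag_real[OF wX]
        kernel_hermitian[OF wX wX] kernel_hermitian[OF y y]
      by (simp add: complex_eq_iff[of _ "of_real _"] Im_divide)
    have Dw: "(\<Sum>a<n. D w a * cnj (D z a)) = F w z" if "z \<in> S" for z
    proof (cases "z = y")
      case True
      then show ?thesis using Dy nv[OF wX y] nv[OF y y] by (simp add: F_def)
    next
      case zy: False
      have zX: "z \<in> X" "w \<noteq> z" using that S False by auto
      then have "row_contr k {w, z, y} n D" using wX y by (intro DT) auto
      then show ?thesis
        unfolding F_def
        by (rule row_contr_forced_entry[OF _ wX zX(1) y zX(2) wy zy nv[OF y y] nv[OF wX zX(1)]
            nv[OF zX(1) zX(1)] Dy DS[OF that that, unfolded F_def]])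
    qed
    \<comment> \<open>The new coordinate vanishes off \<open>w\<close>, so all inner products with
      old vectors survive; \<open>dF\<close> makes the radicand nonnegative.\<close>
    define E where "E = (\<lambda>x a. if a < n then D x a
      else if x = w then complex_of_real (sqrt (Re (F w w) - d)) else 0)"
    have E: "(\<Sum>a<Suc n. E x a * cnj (E z a)) = (\<Sum>a<n. D x a * cnj (D z a)) + E x n * cnj (E z n)" for x z
      by (simp add: E_def)
    have Fcnj: "cnj (F w z) = F z w" if "z \<in> S" for z
    proof -
      have "z \<in> X" using that S by blast
      then show ?thesis
        unfolding F_def using kernel_hermitian[OF wX y] kernel_hermitian[OF y \<open>z \<in> X\<close>]
          kernel_hermitian[OF wX \<open>z \<in> X\<close>] kernel_hermitian[OF y y]
        by (simp add: mult.commute)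
    qed
    have "(\<Sum>a<Suc n. E x a * cnj (E z a)) = F x z"
      if xz: "x \<in> insert w S" "z \<in> insert w S" for x z
    proof -
      consider "x = w" "z = w" | "x = w" "z \<in> S" | "x \<in> S" "z = w" | "x \<in> S" "z \<in> S"
        using xz by blast
      then show ?thesis
      proof cases
        case 1
        have "E w n * cnj (E w n) = of_real (Re (F w w) - d)"
          using dF by (simp add: E_def flip: of_real_mult of_real_diff)
        then show ?thesis using 1 d Fww unfolding E by simp
      next
        case 2
        then show ?thesis using False Dw unfolding E by (auto simp: E_def)
      next
        case 3
        have "(\<Sum>a<n. D x a * cnj (D w a)) = cnj (\<Sum>a<n. D w a * cnj (D x a))"
          by (simp add: mult.commute)
        then show ?thesis using 3 False Dw[of x] Fcnj[of x] unfolding E by (auto simp: E_def)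
      next
        case 4
        then show ?thesis using False DS unfolding E by (auto simp: E_def)
      qed
    qed
    moreover have "insert y (insert w T) = insert w S" unfolding S_def by auto
    ultimately show ?thesis
      unfolding F_def by (intro exI[of _ "Suc n"] exI[of _ E]) auto
  qed
qed

text \<open>With Gram vectors \<open>B\<close>, the Pick matrix of \<open>1 - g\<close> splits into
  the rank one form at \<open>w\<close> and a positive multiple of \<open>k\<close> times the Gram
  matrix of the vectors \<open>g x * (B x - B w)\<close>. Each coordinate of the latter contributes
  a value of \<open>ksq\<close>, so both parts are positive.\<close>

lemma kcontr_normalized_kernel:
  assumes pick: "complete_pick X H ip k" and nonzero: "\<forall>x\<in>X. \<forall>z\<in>X. k x z \<noteq> 0"
    and S: "finite S" "S \<subseteq> X" and yw: "y \<in> S" "w \<in> S"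
  shows "kcontr k S (\<lambda>x. 1 - k x w * k w y / (k x y * k w w))"
  unfolding kcontr_def
proof
  fix c
  note nv = nonzero[rule_format]
  have X: "y \<in> X" "w \<in> X" and ins: "insert y S = S" using S yw by auto
  obtain n :: nat and B where "\<forall>x\<in>S. \<forall>z\<in>S.
      (\<Sum>a<n. B x a * cnj (B z a)) = 1 - k x y * k y z / (k y y * k x z)"
    using pick_gram_vectors[OF pick nonzero X(1) S] unfolding ins by blast
  note B = this[rule_format]
  define g where "g = (\<lambda>x. k x w * k w y / (k x y * k w w))"
  define D where "D = (\<lambda>x a. B x a - B w a)"
  \<comment> \<open>The value at \<open>w\<close> of the kernel normalized at \<open>y\<close>, that
    is, the reciprocal of one minus the squared length of \<open>B w\<close>; \<open>g\<close> is
    this normalized kernel at \<open>w\<close> divided by \<open>K\<close>.\<close>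
  define K where "K = Re (k w w) * Re (k y y) / (cmod (k w y))\<^sup>2"
  have K: "K \<ge> 0"
    unfolding K_def using kernel_diag_pos[OF X(1) nv[OF X(1,1)]] kernel_diag_pos[OF X(2) nv[OF X(2,2)]]
    by simp
  have cK: "of_real K = k w w * k y y / (k w y * k y w)"
    unfolding K_def of_real_divide of_real_mult complex_norm_square
    using kernel_diag_real[OF X(1)] kernel_diag_real[OF X(2)] kernel_hermitian[OF X(2,1)] by simp
  have key: "k x z * (1 - (1 - g x) * cnj (1 - g z)) =
      k x w * k w z / k w w + of_real K * (\<Sum>a<n. (g x * D x a) * cnj (g z * D z a) * k x z)"
    if xz: "x \<in> S" "z \<in> S" for x z
  proof -
    have xX: "x \<in> X" "z \<in> X" using xz S by auto
    have cg: "cnj (g z) = k w z * k y w / (k y z * k w w)"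
      unfolding g_def using kernel_hermitian[OF xX(2) X(2)] kernel_hermitian[OF X(2,1)]
        kernel_hermitian[OF xX(2) X(1)] kernel_hermitian[OF X(2,2)] by simp
    have "(\<Sum>a<n. D x a * cnj (D z a)) = (\<Sum>a<n. B x a * cnj (B z a)) - (\<Sum>a<n. B x a * cnj (B w a))
        - (\<Sum>a<n. B w a * cnj (B z a)) + (\<Sum>a<n. B w a * cnj (B w a))"
      unfolding D_def sum_subtractf[symmetric] sum.distrib[symmetric]
      by (intro sum.cong refl) (simp add: algebra_simps)
    also have "\<dots> = - k x y * k y z / (k y y * k x z) + k x y * k y w / (k y y * k x w)
        + k w y * k y z / (k y y * k w z) - k w y * k y w / (k y y * k w w)"
      using xz yw by (simp add: B)
    finally have DD: "(\<Sum>a<n. D x a * cnj (D z a)) =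
        - k x y * k y z / (k y y * k x z) + k x y * k y w / (k y y * k x w)
        + k w y * k y z / (k y y * k w z) - k w y * k y w / (k y y * k w w)" .
    have SS: "(\<Sum>a<n. (g x * D x a) * cnj (g z * D z a) * k x z) =
        g x * cnj (g z) * k x z * (\<Sum>a<n. D x a * cnj (D z a))"
      unfolding sum_distrib_left by (intro sum.cong refl) (simp add: algebra_simps)
    show ?thesis
      unfolding SS DD cK complex_cnj_diff complex_cnj_one cg
      using nv[OF xX] nv[OF xX(1) X(1)] nv[OF xX(1) X(2)] nv[OF X(1) xX(2)] nv[OF X(2) xX(2)]
        nv[OF X] nv[OF X(2,1)] nv[OF X(1,1)] nv[OF X(2,2)]
      by (simp add: g_def field_simps)
  qed
  have "ksq k S c - ksq k S (\<lambda>x. c x * cnj (1 - g x)) =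
      Re (\<Sum>x\<in>S. \<Sum>z\<in>S. cnj (c x) * c z * (k x w * k w z / k w w +
        of_real K * (\<Sum>a<n. (g x * D x a) * cnj (g z * D z a) * k x z)))"
    unfolding kcontr_eq using key by (intro arg_cong[where f = Re] sum.cong refl) simp
  also have "(\<Sum>x\<in>S. \<Sum>z\<in>S. cnj (c x) * c z * (k x w * k w z / k w w +
        of_real K * (\<Sum>a<n. (g x * D x a) * cnj (g z * D z a) * k x z))) =
      (\<Sum>x\<in>S. \<Sum>z\<in>S. cnj (c x) * c z * (k x w * k w z / k w w)) +
      of_real K * (\<Sum>x\<in>S. \<Sum>z\<in>S. \<Sum>a<n. cnj (c x * cnj (g x * D x a)) * (c z * cnj (g z * D z a)) * k x z)"
    by (simp add: sum_distrib_left sum.distrib algebra_simps)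
  also have "\<dots> = of_real ((cmod (\<Sum>z\<in>S. c z * k w z))\<^sup>2 / Re (k w w) +
      K * (\<Sum>a<n. ksq k S (\<lambda>x. c x * cnj (g x * D x a))))"
    by (simp only: sum_swap3[where R="{..<n}" and S=S and T=S] rank_one_form[OF S(2) X(2)]
        kernel_sum_eq_ksq[OF S] of_real_add of_real_mult of_real_sum)
  finally have "ksq k S c - ksq k S (\<lambda>x. c x * cnj (1 - g x)) =
      (cmod (\<Sum>z\<in>S. c z * k w z))\<^sup>2 / Re (k w w) +
      K * (\<Sum>a<n. ksq k S (\<lambda>x. c x * cnj (g x * D x a)))"
    by (simp only: Re_complex_of_real)
  moreover have "0 \<le> (cmod (\<Sum>z\<in>S. c z * k w z))\<^sup>2 / Re (k w w)"
    using kernel_diag_pos[OF X(2) nv[OF X(2,2)]] by simp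
  moreover have "0 \<le> K * (\<Sum>a<n. ksq k S (\<lambda>x. c x * cnj (g x * D x a)))"
    using K S by (intro mult_nonneg_nonneg sum_nonneg ksq_nonneg) auto
  ultimately show "ksq k S (\<lambda>x. c x * cnj (1 - k x w * k w y / (k x y * k w w))) \<le> ksq k S c"
    unfolding g_def by linarith
qed

end

section \<open>Gram matrix bounds\<close>

lemma exp_le_one_minus:
  fixes x t :: real
  assumes "0 < t" "0 \<le> x" "x \<le> 1 - t"
  shows "exp (- (x / t)) \<le> 1 - x"
proof -
  have "(1 + x / t) * (1 - x) = 1 + x / t * (1 - t - x)"
    using assms(1) by (simp add: field_simps)
  also have "\<dots> \<ge> 1" using assms by simp
  finally have "1 \<le> (1 + x / t) * (1 - x)" .
  also have "\<dots> \<le> exp (x / t) * (1 - x)"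
    using assms by (intro mult_right_mono exp_ge_add_one_self) auto
  finally show ?thesis by (simp add: exp_minus field_simps)
qed

text \<open>A bound independent of the number of factors, as long as each factor is at least
  \<open>t\<close>. It serves with \<open>t = 1 / 2\<close> in \<open>telescoping_row\<close> and
  with \<open>t = \<delta>\<close> in \<open>strong_separation\<close>.\<close>

lemma prod_one_minus_ge_exp:
  fixes x :: "'a \<Rightarrow> real"
  assumes "finite I" "0 < t" "\<And>i. i \<in> I \<Longrightarrow> 0 \<le> x i \<and> x i \<le> 1 - t" "(\<Sum>i\<in>I. x i) \<le> C"
  shows "exp (- (C / t)) \<le> (\<Prod>i\<in>I. 1 - x i)"
proof -
  have "exp (- (C / t)) \<le> exp (\<Sum>i\<in>I. - (x i / t))"
    using assms(2,4) by (simp add: sum_negf sum_divide_distrib[symmetric] divide_right_mono)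
  also have "\<dots> = (\<Prod>i\<in>I. exp (- (x i / t)))"
    using assms(1) by (rule exp_sum)
  also have "\<dots> \<le> (\<Prod>i\<in>I. 1 - x i)"
    using assms(2,3) by (intro prod_mono) (auto intro: exp_le_one_minus)
  finally show ?thesis .
qed

text \<open>\<open>1 - s * g\<close> is the convex combination of 1 and the contraction
  \<open>1 - g\<close>, and these differ by \<open>g\<close>; the deficit in
  \<open>ksq_convex_comb\<close> therefore controls \<open>g\<close>.\<close>

lemma kcontr_step:
  assumes "kcontr k S (\<lambda>x. 1 - g x)" "0 \<le> s"
  shows "s * (1 - s) * ksq k S (\<lambda>x. c x * cnj (g x)) +
    ksq k S (\<lambda>x. c x * cnj (1 - of_real s * g x)) \<le> ksq k S c"
proof -
  have "ksq k S (\<lambda>x. c x * cnj (1 - of_real s * g x)) =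
      (1 - s) * ksq k S c + s * ksq k S (\<lambda>x. c x * cnj (1 - g x))
      - s * (1 - s) * ksq k S (\<lambda>x. c x * cnj (g x))"
    using ksq_convex_comb[of k S s c "\<lambda>x. c x * cnj (1 - g x)"] by (simp add: algebra_simps)
  moreover have "s * ksq k S (\<lambda>x. c x * cnj (1 - g x)) \<le> s * ksq k S c"
    using assms unfolding kcontr_def by (intro mult_left_mono) auto
  ultimately show ?thesis by (simp add: algebra_simps)
qed

context rkhs
begin

lemma kcontr_norm_le_1:
  assumes "finite S" "x \<in> S" "x \<in> X" "k x x \<noteq> 0" "kcontr k S \<phi>"
  shows "cmod (\<phi> x) \<le> 1"
proof -
  define c where "c = (\<lambda>u. if u = x then 1 else 0 :: complex)"
  have "ksq k S (\<lambda>u. c u * cnj (\<phi> u)) = (cmod (\<phi> x))\<^sup>2 * Re (k x x)"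
    using assms by (subst ksq_single[of S x]) (auto simp: c_def)
  moreover have "ksq k S c = Re (k x x)"
    using assms by (subst ksq_single[of S x]) (auto simp: c_def)
  ultimately have "(cmod (\<phi> x))\<^sup>2 * Re (k x x) \<le> 1 * Re (k x x)"
    using assms(5) unfolding kcontr_def by (metis mult_1)
  then have "(cmod (\<phi> x))\<^sup>2 \<le> 1\<^sup>2"
    using kernel_diag_pos assms by (subst (asm) mult_le_cancel_right_pos) auto
  then show ?thesis by (rule power2_le_imp_le) simp
qed

text \<open>Duality: for \<open>f = kcomb k S c\<close> the squared norm is the sum of
  \<open>cnj (c x) * f x\<close>, and the Carleson bound for this same \<open>f\<close> controls the
  values \<open>f x\<close>.\<close>

lemma gram_upper_bound:
  assumes S: "finite S" "S \<subseteq> X" and diag: "\<forall>x\<in>X. k x x \<noteq> 0" and C: "C > 0"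
    and carleson: "\<And>f. f \<in> H \<Longrightarrow> (\<Sum>x\<in>S. (cmod (f x))\<^sup>2 / Re (k x x)) \<le> C * Re (ip f f)"
  shows "ksq k S c \<le> C * (\<Sum>x\<in>S. (cmod (c x))\<^sup>2 * Re (k x x))"
proof -
  define f where "f = kcomb k S c"
  have f: "f \<in> H" unfolding f_def using S by (rule kcomb_mem)
  have K: "Re (k x x) > 0" if "x \<in> S" for x using that S diag kernel_diag_pos by blast
  have "Re (ip f f) = Re (\<Sum>x\<in>S. cnj (c x) * f x)"
    by (subst (2) f_def) (simp only: ip_kcomb[OF S f])
  also have "\<dots> \<le> (\<Sum>x\<in>S. cmod (c x) * cmod (f x))"
    unfolding Re_sum
    by (intro sum_mono order.trans[OF complex_Re_le_cmod]) (simp add: norm_mult)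
  \<comment> \<open>The arithmetic-geometric mean inequality is weighted so that the Carleson bound
    returns half of \<open>Re (ip f f)\<close>, which is absorbed on the left.\<close>
  also have "\<dots> \<le> (\<Sum>x\<in>S. (C * ((cmod (c x))\<^sup>2 * Re (k x x)) + (cmod (f x))\<^sup>2 / Re (k x x) / C) / 2)"
  proof (intro sum_mono)
    fix x assume "x \<in> S"
    have "0 \<le> (C * Re (k x x) * cmod (c x) - cmod (f x))\<^sup>2 / (C * Re (k x x))"
      using C K[OF \<open>x \<in> S\<close>] by simp
    also have "\<dots> = C * ((cmod (c x))\<^sup>2 * Re (k x x)) + (cmod (f x))\<^sup>2 / Re (k x x) / C
        - 2 * (cmod (c x) * cmod (f x))"
      using C K[OF \<open>x \<in> S\<close>] by (simp add: field_simps power2_eq_square)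
    finally show "cmod (c x) * cmod (f x) \<le>
        (C * ((cmod (c x))\<^sup>2 * Re (k x x)) + (cmod (f x))\<^sup>2 / Re (k x x) / C) / 2" by simp
  qed
  also have "\<dots> = (C * (\<Sum>x\<in>S. (cmod (c x))\<^sup>2 * Re (k x x)) + (\<Sum>x\<in>S. (cmod (f x))\<^sup>2 / Re (k x x)) / C) / 2"
    by (simp only: sum_divide_distrib[symmetric] sum.distrib sum_distrib_left[symmetric])
  also have "\<dots> \<le> (C * (\<Sum>x\<in>S. (cmod (c x))\<^sup>2 * Re (k x x)) + Re (ip f f)) / 2"
    using carleson[OF f] C by (simp add: field_simps)
  finally show ?thesis unfolding ksq_eq_ip[OF S] f_def[symmetric] by simp
qed

text \<open>The sum of the row sums, weighted by \<open>\<bar>k j y\<bar>\<^sup>2 / k j j\<close>, is a value of the quadratic form of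
  the kernel; hence some row sum is at most the upper Gram bound.\<close>

lemma exists_small_row_sum:
  assumes E: "finite E" "E \<subseteq> X" "E \<noteq> {}" and y: "y \<in> X"
    and nonzero: "\<forall>x\<in>X. \<forall>z\<in>X. k x z \<noteq> 0"
    and upper: "\<And>c. ksq k E c \<le> C * (\<Sum>x\<in>E. (cmod (c x))\<^sup>2 * Re (k x x))"
  shows "\<exists>j\<in>E. (\<Sum>i\<in>E. Re (k j i * k i y / (k j y * k i i))) \<le> C"
proof (rule ccontr)
  assume "\<not> ?thesis"
  then have less: "C < (\<Sum>i\<in>E. Re (k j i * k i y / (k j y * k i i)))" if "j \<in> E" for j
    using that by force
  define m where "m = (\<lambda>j. (cmod (k j y))\<^sup>2 / Re (k j j))"
  define c where "c = (\<lambda>i. k i y / k i i)"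
  have m: "m j > 0" if "j \<in> E" for j
    using that E y nonzero kernel_diag_pos[of j] unfolding m_def by auto
  have K: "cmod (k j j) = Re (k j j)" if "j \<in> E" for j
    using that E nonzero kernel_diag_pos[of j] kernel_diag_real[of j]
    by (metis abs_of_pos norm_of_real subsetD)
  \<comment> \<open>The weight \<open>m j\<close> cancels the denominator \<open>k j y\<close> and
    leaves \<open>cnj (c j)\<close>, which makes the weighted row sums symmetric in form.\<close>
  have entry: "of_real (m j) * (k j i * k i y / (k j y * k i i)) = cnj (c j) * c i * k j i"
    if ij: "i \<in> E" "j \<in> E" for i j
  proof -
    have X: "i \<in> X" "j \<in> X" using ij E by auto
    have "of_real (m j) = k j y * cnj (k j y) / k j j"
      unfolding m_def of_real_divide complex_norm_square kernel_diag_real[OF X(2), symmetric] ..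
    moreover have "cnj (k j j) = k j j" using kernel_hermitian[OF X(2,2)] by simp
    ultimately show ?thesis
      using nonzero X y by (simp add: c_def field_simps)
  qed
  have "C * (\<Sum>j\<in>E. m j) < (\<Sum>j\<in>E. m j * (\<Sum>i\<in>E. Re (k j i * k i y / (k j y * k i i))))"
    unfolding sum_distrib_left using E less m
    by (intro sum_strict_mono) (auto simp: mult.commute[of C] mult_strict_left_mono sum_distrib_left[symmetric])
  also have "\<dots> = Re (\<Sum>j\<in>E. \<Sum>i\<in>E. of_real (m j) * (k j i * k i y / (k j y * k i i)))"
    by (simp only: sum_distrib_left Re_sum times_complex.sel Re_complex_of_real
        Im_complex_of_real mult_zero_left diff_zero)
  also have "\<dots> = ksq k E c"
    unfolding ksq_def using entry by (intro arg_cong[where f = Re] sum.cong refl) auto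
  also have "\<dots> \<le> C * (\<Sum>x\<in>E. (cmod (c x))\<^sup>2 * Re (k x x))" by (rule upper)
  also have "(\<Sum>x\<in>E. (cmod (c x))\<^sup>2 * Re (k x x)) = (\<Sum>j\<in>E. m j)"
    using K E nonzero kernel_diag_pos
    by (intro sum.cong refl) (auto simp: c_def m_def norm_divide power_divide power2_eq_square)
  finally show False by simp
qed

text \<open>A telescoping argument: the order in which points are removed from \<open>E\<close> is chosen so that the
  factors \<open>1 - g i / 8\<close> of \<open>R j\<close> belong to a set of indices \<open>i\<close> with small row sum at \<open>j\<close>.\<close>

lemma telescoping_row:
  assumes S: "finite S" "S \<subseteq> X" and diag: "\<forall>x\<in>X. k x x \<noteq> 0" and C: "C \<ge> 0"
    and contr: "\<And>w. w \<in> S \<Longrightarrow> kcontr k S (\<lambda>x. 1 - g w x)"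
    and g1: "\<And>w. w \<in> S \<Longrightarrow> g w w = 1"
    and small: "\<And>E. E \<subseteq> S \<Longrightarrow> E \<noteq> {} \<Longrightarrow> \<exists>j\<in>E. (\<Sum>i\<in>E. Re (g i j)) \<le> C"
    and E: "E \<subseteq> S"
  shows "\<exists>R. (\<forall>j\<in>E. exp (- (C / 2)) \<le> (cmod (R j j))\<^sup>2) \<and>
    (\<forall>c. 7 / 64 * (\<Sum>j\<in>E. ksq k S (\<lambda>x. c x * cnj (R j x))) +
      ksq k S (\<lambda>x. c x * cnj (\<Prod>i\<in>E. 1 - g i x / 8)) \<le> ksq k S c)"
  using finite_subset[OF E S(1)] E
proof (induction E rule: finite_psubset_induct)
  case (psubset E)
  \<comment> \<open>\<open>1 - g w\<close> has modulus at most 1, so the squared modulus of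
    \<open>g w x\<close> is at most \<open>2 * Re (g w x)\<close>. The factor 1/8 is small enough
    that \<open>1 - Re (g w x) / 4\<close> stays at least 1/2.\<close>
  have g_bounds: "0 \<le> Re (g w x) \<and> Re (g w x) \<le> 2 \<and> 1 - Re (g w x) / 4 \<le> (cmod (1 - g w x / 8))\<^sup>2"
    if "w \<in> S" "x \<in> S" for w x
  proof -
    have "cmod (1 - g w x) \<le> 1"
      using kcontr_norm_le_1[OF S(1) that(2) _ _ contr[OF that(1)]] that S diag by blast
    then have "(cmod (1 - g w x))\<^sup>2 \<le> 1" by (simp add: power_le_one)
    then have *: "(Re (g w x))\<^sup>2 + (Im (g w x))\<^sup>2 \<le> 2 * Re (g w x)"
      unfolding cmod_power2 by (simp add: power2_eq_square algebra_simps)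
    then have "0 \<le> Re (g w x)"
      using zero_le_power2[of "Re (g w x)"] zero_le_power2[of "Im (g w x)"] by linarith
    moreover have "Re (g w x) * Re (g w x) \<le> 2 * Re (g w x)"
      using * zero_le_power2[of "Im (g w x)"] unfolding power2_eq_square by linarith
    then have "Re (g w x) \<le> 2"
      using \<open>0 \<le> Re (g w x)\<close> by (cases "Re (g w x) = 0") auto
    moreover have "1 - Re (g w x) / 4 \<le> (cmod (1 - g w x / 8))\<^sup>2"
      unfolding cmod_power2 by (simp add: power2_eq_square algebra_simps)
    ultimately show ?thesis by blast
  qed
  show ?case
  proof (cases "E = {}")
    case True
    then show ?thesis by simp
  next
    case False
    obtain j where j: "j \<in> E" "(\<Sum>i\<in>E. Re (g i j)) \<le> C"
      using small[OF psubset.prems False] by blast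
    define E' where "E' = E - {j}"
    have E': "E = insert j E'" "j \<notin> E'" "E' \<subset> E" "finite E'"
      using j psubset.hyps by (auto simp: E'_def)
    obtain R where R: "\<And>i. i \<in> E' \<Longrightarrow> exp (- (C / 2)) \<le> (cmod (R i i))\<^sup>2"
      "\<And>c. 7 / 64 * (\<Sum>i\<in>E'. ksq k S (\<lambda>x. c x * cnj (R i x))) +
        ksq k S (\<lambda>x. c x * cnj (\<Prod>i\<in>E'. 1 - g i x / 8)) \<le> ksq k S c"
      using psubset.IH[OF E'(3)] E'(3) psubset.prems by blast
    define P where "P = (\<lambda>x. \<Prod>i\<in>E'. 1 - g i x / 8)"
    \<comment> \<open>The point \<open>j\<close> removed from \<open>E\<close> gets the factors of
      all remaining points; its small row sum over \<open>E\<close> keeps their product at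
      \<open>j\<close> away from zero. The other rows are left as they were.\<close>
    define R' where "R' = (\<lambda>i x. if i = j then g j x * P x else R i x)"
    have "exp (- (C / 2)) \<le> (cmod (R' i i))\<^sup>2" if "i \<in> E" for i
    proof (cases "i = j")
      case True
      have jS: "j \<in> S" using j psubset.prems by blast
      have "(\<Sum>i\<in>E'. Re (g i j)) \<le> (\<Sum>i\<in>E. Re (g i j))"
        using psubset.prems jS g_bounds psubset.hyps E'(1) by (intro sum_mono2) auto
      then have "(\<Sum>i\<in>E'. Re (g i j) / 4) \<le> C / 4"
        using j(2) by (simp add: sum_divide_distrib[symmetric])
      then have "exp (- (C / 4 / (1 / 2))) \<le> (\<Prod>i\<in>E'. 1 - Re (g i j) / 4)"
        using g_bounds psubset.prems jS E'(1) by (intro prod_one_minus_ge_exp E'(4)) auto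
      also have "\<dots> \<le> (\<Prod>i\<in>E'. (cmod (1 - g i j / 8))\<^sup>2)"
      proof (intro prod_mono conjI)
        fix i assume "i \<in> E'"
        then have "i \<in> S" using E'(1) psubset.prems by blast
        then show "1 - Re (g i j) / 4 \<le> (cmod (1 - g i j / 8))\<^sup>2" "0 \<le> 1 - Re (g i j) / 4"
          using g_bounds[OF _ jS, of i] by auto
      qed
      also have "\<dots> = (cmod (R' i i))\<^sup>2"
        using True g1[OF jS] by (simp add: R'_def P_def prod_norm[symmetric] prod_power_distrib)
      finally show ?thesis by simp
    next
      case False
      then show ?thesis using R(1)[of i] that E'(1) by (simp add: R'_def)
    qed
    moreover have "7 / 64 * (\<Sum>i\<in>E. ksq k S (\<lambda>x. c x * cnj (R' i x))) +
        ksq k S (\<lambda>x. c x * cnj (\<Prod>i\<in>E. 1 - g i x / 8)) \<le> ksq k S c" for c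
    proof -
      \<comment> \<open>\<open>kcontr_step\<close> with \<open>s = 1 / 8\<close>, applied to the
        coefficients after the adjoint of \<open>P\<close>; this is where 7/64 comes from.\<close>
      have "1 / 8 * (1 - 1 / 8) * ksq k S (\<lambda>x. (c x * cnj (P x)) * cnj (g j x)) +
          ksq k S (\<lambda>x. (c x * cnj (P x)) * cnj (1 - of_real (1 / 8) * g j x)) \<le>
          ksq k S (\<lambda>x. c x * cnj (P x))"
        using j psubset.prems by (intro kcontr_step contr) auto
      moreover have "(\<lambda>x. (c x * cnj (P x)) * cnj (g j x)) = (\<lambda>x. c x * cnj (R' j x))"
        by (auto simp: R'_def fun_eq_iff)
      moreover have "(\<lambda>x. (c x * cnj (P x)) * cnj (1 - of_real (1 / 8) * g j x)) =
          (\<lambda>x. c x * cnj (\<Prod>i\<in>E. 1 - g i x / 8))"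
        unfolding E'(1) P_def using E'(2,4) by (simp add: fun_eq_iff mult_ac)
      ultimately have "7 / 64 * ksq k S (\<lambda>x. c x * cnj (R' j x)) +
          ksq k S (\<lambda>x. c x * cnj (\<Prod>i\<in>E. 1 - g i x / 8)) \<le> ksq k S (\<lambda>x. c x * cnj (P x))"
        by simp
      moreover have "(\<Sum>i\<in>E. ksq k S (\<lambda>x. c x * cnj (R' i x))) =
          ksq k S (\<lambda>x. c x * cnj (R' j x)) + (\<Sum>i\<in>E'. ksq k S (\<lambda>x. c x * cnj (R i x)))"
      proof -
        have "R' i = R i" if "i \<in> E'" for i
          using that E'(2) by (auto simp: R'_def fun_eq_iff)
        then have "(\<Sum>i\<in>E'. ksq k S (\<lambda>x. c x * cnj (R' i x))) = (\<Sum>i\<in>E'. ksq k S (\<lambda>x. c x * cnj (R i x)))"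
          by (intro sum.cong refl) simp
        then show ?thesis using E'(2,4) by (subst (1) E'(1)) simp
      qed
      ultimately show ?thesis using R(2)[of c] unfolding P_def by argo
    qed
    ultimately show ?thesis by blast
  qed
qed

text \<open>The extremal case of the Schwarz lemma above: with these values at \<open>x\<close> and
  \<open>z\<close> the Pick matrix is the rank one matrix at \<open>z\<close>.\<close>

lemma pick_two_point:
  assumes pick: "complete_pick X H ip k" and xz: "x \<in> X" "z \<in> X" "x \<noteq> z"
    and nz: "k x x \<noteq> 0" "k z z \<noteq> 0"
  obtains \<psi> where "\<psi> z = 0" "(cmod (\<psi> x))\<^sup>2 = 1 - (cmod (k x z))\<^sup>2 / (Re (k x x) * Re (k z z))"
    "\<And>T. finite T \<Longrightarrow> T \<subseteq> X \<Longrightarrow> kcontr k T \<psi>"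
proof -
  define \<rho> where "\<rho> = (cmod (k x z))\<^sup>2 / (Re (k x x) * Re (k z z))"
  have K: "Re (k x x) > 0" "Re (k z z) > 0" using kernel_diag_pos xz nz by auto
  have "(cmod (k x z))\<^sup>2 \<le> Re (k z z) * Re (k x x)"
    using point_evaluation_bound[OF kernel_mem[OF xz(2)] xz(1)] ip_kernels[OF xz(2,2)]
    by (simp add: kernel_fun_def)
  then have \<rho>: "\<rho> \<le> 1" using K by (simp add: \<rho>_def mult.commute)
  have c\<rho>: "of_real \<rho> = k x z * k z x / (k x x * k z z)"
    unfolding \<rho>_def of_real_divide of_real_mult complex_norm_square
    using kernel_diag_real[OF xz(1)] kernel_diag_real[OF xz(2)] kernel_hermitian[OF xz(1,2)] by simp
  define \<phi> where "\<phi> = (\<lambda>u. if u = x then complex_of_real (sqrt (1 - \<rho>)) else 0)"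
  have "\<phi> x * cnj (\<phi> x) = of_real (1 - \<rho>)"
    using \<rho> by (simp add: \<phi>_def del: of_real_diff flip: of_real_mult)
  then have entry: "k u v * (1 - \<phi> u * cnj (\<phi> v)) = k u z * k z v / k z z"
    if "u \<in> {x, z}" "v \<in> {x, z}" for u v
    using that nz xz c\<rho> by (auto simp: \<phi>_def)
  have "kcontr k {x, z} \<phi>"
    unfolding kcontr_def
  proof
    fix c
    have "ksq k {x, z} c - ksq k {x, z} (\<lambda>u. c u * cnj (\<phi> u)) =
        Re (\<Sum>u\<in>{x, z}. \<Sum>v\<in>{x, z}. cnj (c u) * c v * (k u z * k z v / k z z))"
      unfolding kcontr_eq using entry by (intro arg_cong[where f = Re] sum.cong refl) auto
    also have "\<dots> = (cmod (\<Sum>v\<in>{x, z}. c v * k z v))\<^sup>2 / Re (k z z)"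
      using xz by (subst rank_one_form) auto
    also have "\<dots> \<ge> 0" using K by simp
    finally show "ksq k {x, z} (\<lambda>u. c u * cnj (\<phi> u)) \<le> ksq k {x, z} c" by simp
  qed
  then obtain \<psi> where \<psi>: "\<And>u. u \<in> {x, z} \<Longrightarrow> \<psi> u = \<phi> u"
    "\<And>T. finite T \<Longrightarrow> T \<subseteq> X \<Longrightarrow> kcontr k T \<psi>"
    using pick_scalar[OF pick, of "{x, z}"] xz by blast
  have "\<psi> z = 0" "(cmod (\<psi> x))\<^sup>2 = 1 - \<rho>"
    using \<psi>(1) xz(3) \<rho> by (auto simp: \<phi>_def)
  then show thesis using that \<psi>(2) unfolding \<rho>_def by blast
qed

text \<open>A product of two-point multipliers, one for each other point. The Carleson bound for the
  kernel function at \<open>j\<close> bounds the sum of the \<open>\<rho> i\<close>, and separation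
  keeps each \<open>1 - \<rho> i\<close> at least \<open>\<delta>\<close>.\<close>

lemma strong_separation:
  assumes pick: "complete_pick X H ip k" and diag: "\<forall>x\<in>X. k x x \<noteq> 0"
    and S: "finite S" "S \<subseteq> X" and \<delta>: "0 < \<delta>"
    and sep: "\<And>x z. x \<in> S \<Longrightarrow> z \<in> S \<Longrightarrow> x \<noteq> z \<Longrightarrow>
      (cmod (k x z))\<^sup>2 / (Re (k x x) * Re (k z z)) \<le> 1 - \<delta>"
    and carleson: "\<And>f. f \<in> H \<Longrightarrow> (\<Sum>x\<in>S. (cmod (f x))\<^sup>2 / Re (k x x)) \<le> C * Re (ip f f)"
    and j: "j \<in> S"
  obtains \<phi> where "kcontr k S \<phi>" "\<And>i. i \<in> S \<Longrightarrow> i \<noteq> j \<Longrightarrow> \<phi> i = 0"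
    "exp (- (C / \<delta>)) \<le> (cmod (\<phi> j))\<^sup>2"
proof -
  have K: "Re (k x x) > 0" if "x \<in> S" for x using that S diag kernel_diag_pos by blast
  define \<rho> where "\<rho> = (\<lambda>i. (cmod (k j i))\<^sup>2 / (Re (k j j) * Re (k i i)))"
  have "\<forall>i\<in>S - {j}. \<exists>\<psi>. \<psi> i = 0 \<and> (cmod (\<psi> j))\<^sup>2 = 1 - \<rho> i \<and> kcontr k S \<psi>"
  proof
    fix i assume "i \<in> S - {j}"
    then have "j \<in> X" "i \<in> X" "j \<noteq> i" using S j by auto
    then show "\<exists>\<psi>. \<psi> i = 0 \<and> (cmod (\<psi> j))\<^sup>2 = 1 - \<rho> i \<and> kcontr k S \<psi>"
      using pick_two_point[OF pick, of j i] diag S unfolding \<rho>_def by metis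
  qed
  then obtain \<psi> where \<psi>: "\<And>i. i \<in> S - {j} \<Longrightarrow> \<psi> i i = 0"
    "\<And>i. i \<in> S - {j} \<Longrightarrow> (cmod (\<psi> i j))\<^sup>2 = 1 - \<rho> i"
    "\<And>i. i \<in> S - {j} \<Longrightarrow> kcontr k S (\<psi> i)"
    by metis
  define \<phi> where "\<phi> = (\<lambda>x. \<Prod>i\<in>S - {j}. \<psi> i x)"
  have "kcontr k S \<phi>" unfolding \<phi>_def using S \<psi>(3) by (intro kcontr_prod) auto
  moreover have "\<phi> i = 0" if "i \<in> S" "i \<noteq> j" for i
    unfolding \<phi>_def using that S \<psi>(1) by (intro prod_zero) auto
  moreover have "exp (- (C / \<delta>)) \<le> (cmod (\<phi> j))\<^sup>2"
  proof -
    have jX: "j \<in> X" using j S by blast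
    have cmod_swap: "cmod (k j i) = cmod (k i j)" if "i \<in> S" for i
      using kernel_hermitian[of i j] that S jX by (metis complex_mod_cnj subsetD)
    have "(\<Sum>i\<in>S - {j}. \<rho> i) \<le> (\<Sum>i\<in>S. \<rho> i)"
      using S K j by (intro sum_mono2) (auto simp: \<rho>_def less_imp_le)
    also have "\<dots> = (\<Sum>i\<in>S. (cmod (kernel_fun k j i))\<^sup>2 / Re (k i i)) / Re (k j j)"
      unfolding sum_divide_distrib \<rho>_def
      by (intro sum.cong refl) (simp add: cmod_swap kernel_fun_def mult.commute)
    also have "\<dots> \<le> C * Re (k j j) / Re (k j j)"
      using carleson[OF kernel_mem[OF jX]] ip_kernels[OF jX jX] K[OF j]
      by (intro divide_right_mono) auto
    finally have "(\<Sum>i\<in>S - {j}. \<rho> i) \<le> C" using K[OF j] by simp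
    moreover have "0 \<le> \<rho> i \<and> \<rho> i \<le> 1 - \<delta>" if "i \<in> S - {j}" for i
      using that sep[OF j, of i] K j by (auto simp: \<rho>_def less_imp_le)
    ultimately have "exp (- (C / \<delta>)) \<le> (\<Prod>i\<in>S - {j}. 1 - \<rho> i)"
      using S \<delta> by (intro prod_one_minus_ge_exp) auto
    also have "\<dots> = (\<Prod>i\<in>S - {j}. (cmod (\<psi> i j))\<^sup>2)"
      using \<psi>(2) by (intro prod.cong refl) auto
    also have "\<dots> = (cmod (\<phi> j))\<^sup>2"
      by (simp add: \<phi>_def prod_norm[symmetric] prod_power_distrib)
    finally show ?thesis .
  qed
  ultimately show thesis by (rule that)
qed

text \<open>Following the adjoint of \<open>R j\<close> by that of the separating multiplier of
  \<open>j\<close> isolates the coefficient at \<open>j\<close>. Contractivity bounds the isolated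
  term by a summand of the telescoped sum.\<close>

lemma gram_lower_bound:
  assumes pick: "complete_pick X H ip k" and nonzero: "\<forall>x\<in>X. \<forall>z\<in>X. k x z \<noteq> 0"
    and S: "finite S" "S \<subseteq> X" and \<delta>: "0 < \<delta>" and C: "0 < C"
    and sep: "\<And>x z. x \<in> S \<Longrightarrow> z \<in> S \<Longrightarrow> x \<noteq> z \<Longrightarrow>
      (cmod (k x z))\<^sup>2 / (Re (k x x) * Re (k z z)) \<le> 1 - \<delta>"
    and carleson: "\<And>f. f \<in> H \<Longrightarrow> (\<Sum>x\<in>S. (cmod (f x))\<^sup>2 / Re (k x x)) \<le> C * Re (ip f f)"
  shows "7 / 64 * exp (- (C / 2)) * exp (- (C / \<delta>)) * (\<Sum>x\<in>S. (cmod (c x))\<^sup>2 * Re (k x x)) \<le> ksq k S c"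
proof (cases "S = {}")
  case True
  then show ?thesis by (simp add: ksq_def)
next
  case False
  \<comment> \<open>Any point of \<open>S\<close> may serve as the base point of the
    normalization.\<close>
  then obtain y where y: "y \<in> S" by blast
  have diag: "\<forall>x\<in>X. k x x \<noteq> 0" using nonzero by blast
  have K: "Re (k x x) > 0" if "x \<in> S" for x using that S diag kernel_diag_pos by blast
  define g where "g = (\<lambda>w x. k x w * k w y / (k x y * k w w))"
  have contr: "kcontr k S (\<lambda>x. 1 - g w x)" if "w \<in> S" for w
    unfolding g_def using pick nonzero S y that by (rule kcontr_normalized_kernel)
  have small: "\<exists>j\<in>E. (\<Sum>i\<in>E. Re (g i j)) \<le> C" if E: "E \<subseteq> S" "E \<noteq> {}" for E
    unfolding g_def
  proof (rule exists_small_row_sum)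
    show "finite E" "E \<subseteq> X" "E \<noteq> {}" "y \<in> X" using E S y finite_subset by auto
    then show "ksq k E c \<le> C * (\<Sum>x\<in>E. (cmod (c x))\<^sup>2 * Re (k x x))" for c
    proof (intro gram_upper_bound diag C)
      fix f assume "f \<in> H"
      have "(\<Sum>x\<in>E. (cmod (f x))\<^sup>2 / Re (k x x)) \<le> (\<Sum>x\<in>S. (cmod (f x))\<^sup>2 / Re (k x x))"
        using E S K by (intro sum_mono2) (auto simp: less_imp_le)
      then show "(\<Sum>x\<in>E. (cmod (f x))\<^sup>2 / Re (k x x)) \<le> C * Re (ip f f)"
        using carleson[OF \<open>f \<in> H\<close>] by simp
    qed
  qed (rule nonzero)
  have "g w w = 1" if "w \<in> S" for w
    using that y S nonzero by (auto simp: g_def)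
  then obtain R where R: "\<And>j. j \<in> S \<Longrightarrow> exp (- (C / 2)) \<le> (cmod (R j j))\<^sup>2"
    "\<And>c. 7 / 64 * (\<Sum>j\<in>S. ksq k S (\<lambda>x. c x * cnj (R j x))) +
      ksq k S (\<lambda>x. c x * cnj (\<Prod>i\<in>S. 1 - g i x / 8)) \<le> ksq k S c"
    using telescoping_row[OF S diag less_imp_le[OF C] contr _ small order_refl] by blast
  have "exp (- (C / 2)) * exp (- (C / \<delta>)) * ((cmod (c j))\<^sup>2 * Re (k j j)) \<le>
      ksq k S (\<lambda>x. c x * cnj (R j x))" if j: "j \<in> S" for j
  proof -
    obtain \<phi> where \<phi>: "kcontr k S \<phi>" "\<And>i. i \<in> S \<Longrightarrow> i \<noteq> j \<Longrightarrow> \<phi> i = 0"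
      "exp (- (C / \<delta>)) \<le> (cmod (\<phi> j))\<^sup>2"
      using strong_separation[OF pick diag S \<delta> sep carleson j] by blast
    have "exp (- (C / 2)) * exp (- (C / \<delta>)) * ((cmod (c j))\<^sup>2 * Re (k j j)) \<le>
        (cmod (R j j))\<^sup>2 * (cmod (\<phi> j))\<^sup>2 * ((cmod (c j))\<^sup>2 * Re (k j j))"
      using R(1)[OF j] \<phi>(3) K[OF j] by (intro mult_mono mult_nonneg_nonneg) auto
    also have "\<dots> = ksq k S (\<lambda>x. c x * cnj (R j x) * cnj (\<phi> x))"
      using j \<phi>(2) by (subst ksq_single[OF S(1) j]) (auto simp: norm_mult power_mult_distrib)
    also have "\<dots> \<le> ksq k S (\<lambda>x. c x * cnj (R j x))"
      using \<phi>(1) unfolding kcontr_def by (rule spec)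
    finally show ?thesis .
  qed
  then have "exp (- (C / 2)) * exp (- (C / \<delta>)) * (\<Sum>x\<in>S. (cmod (c x))\<^sup>2 * Re (k x x)) \<le>
      (\<Sum>j\<in>S. ksq k S (\<lambda>x. c x * cnj (R j x)))"
    unfolding sum_distrib_left by (rule sum_mono)
  moreover have "0 \<le> ksq k S (\<lambda>x. c x * cnj (\<Prod>i\<in>S. 1 - g i x / 8))"
    using S by (rule ksq_nonneg)
  ultimately show ?thesis using R(2)[of c] by (simp add: mult.assoc)
qed

section \<open>Limits of interpolating multipliers\<close>

lemma parallelogram_half:
  assumes "f \<in> H" "g \<in> H"
  shows "Re (ip (\<lambda>x. f x - g x) (\<lambda>x. f x - g x)) + 4 * Re (ip (\<lambda>x. 1/2 * (f x + g x)) (\<lambda>x. 1/2 * (f x + g x)))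
    = 2 * Re (ip f f) + 2 * Re (ip g g)"
proof -
  have mid: "ip (\<lambda>x. 1/2 * (f x + g x)) (\<lambda>x. 1/2 * (f x + g x)) =
      1/4 * (ip f f + ip f g + ip g f + ip g g)"
    using assms add_mem[OF assms] scale_mem[OF add_mem[OF assms], of "1/2"]
    by (simp only: ip_scale ip_scale_right ip_add ip_add_right) simp
  have diff: "ip (\<lambda>x. f x - g x) (\<lambda>x. f x - g x) = ip f f - ip f g - ip g f + ip g g"
    using assms diff_mem[OF assms] by (simp add: ip_diff ip_diff_right)
  show ?thesis unfolding mid diff by (simp add: add_divide_distrib)
qed

lemma midpoint_norm:
  assumes "f \<in> H" "g \<in> H"
  shows "Re (ip (\<lambda>x. 1/2 * (f x + g x)) (\<lambda>x. 1/2 * (f x + g x))) \<le> (Re (ip f f) + Re (ip g g)) / 2"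
  using parallelogram_half[OF assms] ip_nonneg[OF diff_mem[OF assms]] by simp

lemma norm_convergence_pointwise:
  assumes "\<And>n. h n \<in> H" "g \<in> H" "(\<lambda>n. ip_norm ip (\<lambda>x. h n x - g x)) \<longlonglongrightarrow> 0" "x \<in> X"
  shows "(\<lambda>n. h n x) \<longlonglongrightarrow> g x"
proof -
  have bound: "cmod (h n x - g x) \<le> ip_norm ip (\<lambda>x. h n x - g x) * sqrt (Re (k x x))" for n
    using real_sqrt_le_mono[OF point_evaluation_bound[OF diff_mem[OF assms(1)[of n] assms(2)] assms(4)]]
    by (simp add: ip_norm_def real_sqrt_mult)
  have "(\<lambda>n. cmod (h n x - g x)) \<longlonglongrightarrow> 0"
    by (rule real_tendsto_sandwich[OF _ _ tendsto_const tendsto_mult_left_zero[OF assms(3), of "sqrt (Re (k x x))"]])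
      (intro always_eventually allI norm_ge_zero bound)+
  then have "(\<lambda>n. h n x - g x) \<longlonglongrightarrow> 0" by (rule tendsto_norm_zero_cancel)
  then show ?thesis by (rule LIM_zero_cancel)
qed

text \<open>Elements of almost minimal norm form a Cauchy sequence, by the parallelogram law.\<close>

lemma midpoint_convex_selection:
  fixes C :: "nat \<Rightarrow> ('x \<Rightarrow> complex) set"
  assumes CH: "\<And>n. C n \<subseteq> H" and nonempty: "\<And>n. C n \<noteq> {}" and anti: "\<And>m n. m \<le> n \<Longrightarrow> C n \<subseteq> C m"
    and mid: "\<And>n f g. f \<in> C n \<Longrightarrow> g \<in> C n \<Longrightarrow> (\<lambda>x. 1/2 * (f x + g x)) \<in> C n"
    and bound: "\<And>n f. f \<in> C n \<Longrightarrow> Re (ip f f) \<le> b"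
  obtains h g where "\<And>n. h n \<in> C n" "g \<in> H" "(\<lambda>n. ip_norm ip (\<lambda>x. h n x - g x)) \<longlonglongrightarrow> 0"
proof -
  define q where "q = (\<lambda>f. Re (ip f f))"
  \<comment> \<open>The infima increase because the sets decrease, and they are bounded by
    \<open>b\<close>; hence they converge.\<close>
  define d where "d = (\<lambda>n. Inf (q ` C n))"
  have bdd: "bdd_below (q ` C n)" for n
    using CH ip_nonneg unfolding q_def by (intro bdd_belowI[of _ 0]) auto
  have d_le: "d n \<le> q f" if "f \<in> C n" for n f
    unfolding d_def using bdd that by (intro cInf_lower) auto
  have d_mono: "d m \<le> d n" if "m \<le> n" for m n
    unfolding d_def using anti[OF that] nonempty bdd by (intro cInf_superset_mono) auto
  have d_bound: "d n \<le> b" for n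
  proof -
    obtain f where "f \<in> C n" using nonempty by blast
    then show ?thesis using d_le[of f n] bound[of f n] unfolding q_def by linarith
  qed
  have "norm (d n) \<le> \<bar>d 0\<bar> + \<bar>b\<bar>" for n
    unfolding real_norm_def using d_mono[of 0 n] d_bound[of n] by linarith
  then have "Bseq d" by (rule BseqI')
  moreover have "monoseq d" using d_mono by (intro monoI1) auto
  ultimately have "convergent d" by (rule Bseq_monoseq_convergent)
  then have "Cauchy d" by (rule convergent_Cauchy)
  have "\<exists>f\<in>C n. q f < d n + 1 / real (Suc n)" for n
  proof -
    have "Inf (q ` C n) < d n + 1 / real (Suc n)" unfolding d_def by simp
    then show ?thesis using cInf_lessD[of "q ` C n"] nonempty[of n] by auto
  qed
  then have "\<exists>h. \<forall>n. h n \<in> C n \<and> q (h n) < d n + 1 / real (Suc n)"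
    by (intro choice allI) blast
  then obtain h where h: "\<And>n. h n \<in> C n" "\<And>n. q (h n) < d n + 1 / real (Suc n)" by blast
  have hH: "h n \<in> H" for n using h(1) CH by blast
  have close: "q (\<lambda>x. h m x - h n x) \<le> 2 * \<bar>d m - d n\<bar> + 2 * (1 / real (Suc m)) + 2 * (1 / real (Suc n))" for m n
  proof -
    \<comment> \<open>The midpoint lies in the larger of the two sets, whose infimum bounds its
      squared norm from below; the parallelogram law turns this into a bound for the
      difference.\<close>
    have "(\<lambda>x. 1/2 * (h m x + h n x)) \<in> C (min m n)"
      using h(1)[of m] h(1)[of n] anti[of "min m n" m] anti[of "min m n" n] by (intro mid) auto
    then have "d (min m n) \<le> q (\<lambda>x. 1/2 * (h m x + h n x))" by (rule d_le)
    moreover have "q (\<lambda>x. h m x - h n x) + 4 * q (\<lambda>x. 1/2 * (h m x + h n x)) = 2 * q (h m) + 2 * q (h n)"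
      unfolding q_def using hH hH by (rule parallelogram_half)
    moreover have "2 * d m + 2 * d n - 4 * d (min m n) = 2 * \<bar>d m - d n\<bar>"
      using d_mono[of m n] d_mono[of n m] by (cases "m \<le> n") (auto simp: min_def)
    ultimately show ?thesis using h(2)[of m] h(2)[of n] by simp
  qed
  have "\<exists>M. \<forall>m\<ge>M. \<forall>n\<ge>M. ip_norm ip (\<lambda>x. h m x - h n x) < e" if e: "0 < e" for e
  proof -
    have e8: "0 < e\<^sup>2 / 8" using e by simp
    obtain M1 where M1: "\<And>m n. m \<ge> M1 \<Longrightarrow> n \<ge> M1 \<Longrightarrow> \<bar>d m - d n\<bar> < e\<^sup>2 / 8"
      using CauchyD[OF \<open>Cauchy d\<close> e8] unfolding real_norm_def by blast
    obtain M2 where M2: "inverse (real (Suc M2)) < e\<^sup>2 / 8"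
      using reals_Archimedean[OF e8] by blast
    have less: "a < E" if "A < E / 8" "B < E / 8" "D < E / 8" "a \<le> 2 * D + 2 * A + 2 * B" "0 < E / 8"
      for a A B D E :: real
      using that by linarith
    have "ip_norm ip (\<lambda>x. h m x - h n x) < e" if mn: "m \<ge> max M1 M2" "n \<ge> max M1 M2" for m n
    proof -
      have "1 / real (Suc m) < e\<^sup>2 / 8" "1 / real (Suc n) < e\<^sup>2 / 8"
        using mn M2 le_imp_inverse_le[of "real (Suc M2)" "real (Suc m)"]
          le_imp_inverse_le[of "real (Suc M2)" "real (Suc n)"] by (auto simp: inverse_eq_divide)
      moreover have "\<bar>d m - d n\<bar> < e\<^sup>2 / 8" using M1 mn by simp
      ultimately have "q (\<lambda>x. h m x - h n x) < e\<^sup>2"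
        using close[of m n] e8 by (rule less)
      then show ?thesis
        using real_sqrt_less_mono[of "q (\<lambda>x. h m x - h n x)" "e\<^sup>2"] e
        unfolding ip_norm_def q_def by simp
    qed
    then show ?thesis by blast
  qed
  then obtain g where "g \<in> H" "(\<lambda>n. ip_norm ip (\<lambda>x. h n x - g x)) \<longlonglongrightarrow> 0"
    using complete[of h] hH by blast
  then show thesis using that h(1) by blast
qed

lemma contractive_mult_sq:
  assumes "\<phi> \<in> contractive_mult X H ip" "f \<in> H"
  shows "(\<lambda>x. \<phi> x * f x) \<in> H" "Re (ip (\<lambda>x. \<phi> x * f x) (\<lambda>x. \<phi> x * f x)) \<le> Re (ip f f)"
  using assms unfolding contractive_mult_def ip_norm_def by auto

lemma contractive_mult_midpoint:
  assumes "\<phi> \<in> contractive_mult X H ip" "\<psi> \<in> contractive_mult X H ip"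
  shows "(\<lambda>x. 1/2 * (\<phi> x + \<psi> x)) \<in> contractive_mult X H ip"
proof -
  have "(\<lambda>x. 1/2 * (\<phi> x + \<psi> x) * f x) \<in> H \<and>
      ip_norm ip (\<lambda>x. 1/2 * (\<phi> x + \<psi> x) * f x) \<le> ip_norm ip f" if f: "f \<in> H" for f
  proof -
    have eq: "(\<lambda>x. 1/2 * (\<phi> x + \<psi> x) * f x) = (\<lambda>x. 1/2 * (\<phi> x * f x + \<psi> x * f x))"
      by (simp add: fun_eq_iff algebra_simps)
    note m = contractive_mult_sq[OF assms(1) f] contractive_mult_sq[OF assms(2) f]
    have "Re (ip (\<lambda>x. 1/2 * (\<phi> x * f x + \<psi> x * f x)) (\<lambda>x. 1/2 * (\<phi> x * f x + \<psi> x * f x))) \<le> Re (ip f f)"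
      by (rule order.trans[OF midpoint_norm[OF m(1,3)]]) (use m(2,4) in simp)
    then show ?thesis
      unfolding eq ip_norm_def by (intro conjI scale_mem[OF add_mem[OF m(1,3)]] real_sqrt_le_mono)
  qed
  moreover have "1/2 * (\<phi> x + \<psi> x) = 0" if "x \<notin> X" for x
    using that assms unfolding contractive_mult_def by simp
  ultimately show ?thesis unfolding contractive_mult_def by blast
qed

lemma kernel_dist_lower_bound:
  assumes X: "x \<in> X" "z \<in> X" and c: "0 < c" "c \<le> kernel_dist ip k x z"
  shows "(cmod (k x z))\<^sup>2 / (Re (k x x) * Re (k z z)) \<le> 1 - c\<^sup>2"
proof -
  define \<rho> where "\<rho> = (cmod (k x z))\<^sup>2 / (Re (k x x) * Re (k z z))"
  have "cmod (k z x) = cmod (k x z)" using kernel_hermitian[OF X] by simp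
  then have "kernel_dist ip k x z = sqrt (1 - \<rho>)"
    unfolding kernel_dist_def \<rho>_def ip_kernels[OF X(2,1)] kernel_norm_sq[OF X(1)]
      kernel_norm_sq[OF X(2)] by (simp only:)
  then have le: "c \<le> sqrt (1 - \<rho>)" using c(2) by simp
  \<comment> \<open>\<open>sqrt\<close> of a negative real is negative, so positivity of the
    distance is what shows that \<open>1 - \<rho>\<close> is positive.\<close>
  have "0 < sqrt (1 - \<rho>)" using c(1) le by (rule less_le_trans)
  then have "0 < 1 - \<rho>" by (rule real_sqrt_gt_0_iff[THEN iffD1])
  moreover have "c\<^sup>2 \<le> (sqrt (1 - \<rho>))\<^sup>2" using c(1) le by (intro power_mono) auto
  ultimately show ?thesis unfolding \<rho>_def[symmetric] by simp
qed

text \<open>The sets of multipliers interpolating at the first \<open>n\<close> points decrease, and each is convex. Their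
  action on the nowhere vanishing function \<open>f0\<close> selects a limit \<open>\<phi>\<close>; applied to the multipliers
  that are close to \<open>\<phi>\<close> on \<open>f0\<close>, the same selection shows \<open>\<phi> f \<in> H\<close> for every \<open>f\<close>.\<close>

lemma interpolating_multiplier_limit:
  assumes f0: "f0 \<in> H" "\<And>x. x \<in> X \<Longrightarrow> f0 x \<noteq> 0" and p: "\<And>i. p i \<in> X"
    and ex: "\<And>n::nat. \<exists>\<phi>\<in>contractive_mult X H ip. \<forall>i<n. \<phi> (p i) = w i"
  shows "\<exists>\<phi>\<in>Mult X H. \<forall>i. \<phi> (p i) = w i"
proof -
  define M where "M = (\<lambda>n. {\<phi> \<in> contractive_mult X H ip. \<forall>i<n. \<phi> (p i) = w i})"
  define C where "C = (\<lambda>n. (\<lambda>\<phi> x. \<phi> x * f0 x) ` M n)"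
  have M_mid: "(\<lambda>x. 1/2 * (\<phi> x + \<psi> x)) \<in> M n" if "\<phi> \<in> M n" "\<psi> \<in> M n" for \<phi> \<psi> n
    using that contractive_mult_midpoint[of \<phi> \<psi>] unfolding M_def by auto
  obtain h g where h: "\<And>n. h n \<in> C n" and g: "g \<in> H"
    and lim: "(\<lambda>n. ip_norm ip (\<lambda>x. h n x - g x)) \<longlonglongrightarrow> 0"
  proof (rule midpoint_convex_selection[of C "Re (ip f0 f0)"])
    show "C n \<subseteq> H" "C n \<noteq> {}" for n
      using contractive_mult_sq(1) f0(1) ex[of n] unfolding C_def M_def by auto
    show "C n \<subseteq> C m" if "m \<le> n" for m n
      using that unfolding C_def M_def by (intro image_mono) auto
    show "(\<lambda>x. 1/2 * (f x + g x)) \<in> C n" if fg: "f \<in> C n" "g \<in> C n" for n f g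
    proof -
      obtain \<phi> \<psi> where \<phi>: "\<phi> \<in> M n" "f = (\<lambda>x. \<phi> x * f0 x)" and \<psi>: "\<psi> \<in> M n" "g = (\<lambda>x. \<psi> x * f0 x)"
        using fg unfolding C_def by blast
      show ?thesis
        unfolding C_def
      proof (rule image_eqI)
        show "(\<lambda>x. 1/2 * (f x + g x)) = (\<lambda>x. 1/2 * (\<phi> x + \<psi> x) * f0 x)"
          unfolding \<phi>(2) \<psi>(2) by (simp add: fun_eq_iff algebra_simps)
      qed (rule M_mid[OF \<phi>(1) \<psi>(1)])
    qed
    show "Re (ip f f) \<le> Re (ip f0 f0)" if "f \<in> C n" for n f
      using that contractive_mult_sq(2) f0(1) unfolding C_def M_def by auto
  qed blast
  \<comment> \<open>Division by \<open>f0\<close> recovers the multiplier from its action on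
    \<open>f0\<close>; membership in \<open>Mult X H\<close> requires the value 0 outside
    \<open>X\<close>.\<close>
  define \<phi> where "\<phi> = (\<lambda>x. if x \<in> X then g x / f0 x else 0)"
  have hH: "h n \<in> H" for n
    using h[of n] contractive_mult_sq(1) f0(1) unfolding C_def M_def by auto
  have g_eq: "g = (\<lambda>x. \<phi> x * f0 x)"
    using f0(2) zero_outside[OF g] by (auto simp: \<phi>_def fun_eq_iff)
  have \<phi>w: "\<phi> (p i) = w i" for i
  proof -
    have "h n (p i) = w i * f0 (p i)" if "n > i" for n
      using h[of n] that unfolding C_def M_def by auto
    then have "\<forall>\<^sub>F n in sequentially. h n (p i) = w i * f0 (p i)"
      by (intro eventually_sequentiallyI[of "Suc i"]) auto
    then have "(\<lambda>n. h n (p i)) \<longlonglongrightarrow> w i * f0 (p i)"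
      by (simp add: tendsto_eventually)
    then have "g (p i) = w i * f0 (p i)"
      using norm_convergence_pointwise[OF hH g lim p[of i]] LIMSEQ_unique by blast
    then show ?thesis using f0(2)[OF p[of i]] p[of i] by (simp add: \<phi>_def)
  qed
  have \<phi>H: "(\<lambda>x. \<phi> x * f x) \<in> H" if f: "f \<in> H" for f
  proof -
    \<comment> \<open>The images of \<open>f0\<close> approach \<open>g\<close>, so a limit selected
      from the sets \<open>D n\<close> can only be \<open>\<phi>\<close> times \<open>f\<close>.
      Squared distances let \<open>midpoint_norm\<close> give closure under midpoints.\<close>
    define N where "N = (\<lambda>n::nat. {\<psi> \<in> contractive_mult X H ip.
      Re (ip (\<lambda>x. \<psi> x * f0 x - g x) (\<lambda>x. \<psi> x * f0 x - g x)) \<le> (1 / real (Suc n))\<^sup>2})"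
    define D where "D = (\<lambda>n. (\<lambda>\<psi> x. \<psi> x * f x) ` N n)"
    have N_H: "(\<lambda>x. \<psi> x * f0 x - g x) \<in> H" if "\<psi> \<in> N n" for \<psi> n
      using that contractive_mult_sq(1) f0(1) g unfolding N_def by (intro diff_mem) auto
    obtain u v where u: "\<And>n. u n \<in> D n" and v: "v \<in> H"
      and uv: "(\<lambda>n. ip_norm ip (\<lambda>x. u n x - v x)) \<longlonglongrightarrow> 0"
    proof (rule midpoint_convex_selection[of D "Re (ip f f)"])
      show "D n \<subseteq> H" for n
        using contractive_mult_sq(1) f unfolding D_def N_def by auto
      show "D n \<noteq> {}" for n
      proof -
        \<comment> \<open>A late \<open>h m\<close> is close to \<open>g\<close> and comes from a
          contractive multiplier, which is then in \<open>N n\<close>.\<close>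
        obtain m where "norm (ip_norm ip (\<lambda>x. h m x - g x) - 0) < 1 / real (Suc n)"
          using LIMSEQ_D[OF lim, of "1 / real (Suc n)"] by auto
        then have "(ip_norm ip (\<lambda>x. h m x - g x))\<^sup>2 \<le> (1 / real (Suc n))\<^sup>2"
          by (intro power_mono) (auto simp: ip_norm_nonneg diff_mem hH g)
        then have "Re (ip (\<lambda>x. h m x - g x) (\<lambda>x. h m x - g x)) \<le> (1 / real (Suc n))\<^sup>2"
          by (simp only: ip_norm_sq[OF diff_mem[OF hH g]])
        moreover obtain \<psi> where "\<psi> \<in> M m" "h m = (\<lambda>x. \<psi> x * f0 x)"
          using h[of m] unfolding C_def by blast
        ultimately have "\<psi> \<in> N n"
          unfolding N_def M_def by auto
        then show ?thesis unfolding D_def by blast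
      qed
      show "D n \<subseteq> D m" if "m \<le> n" for m n
      proof -
        have le: "(1 / real (Suc n))\<^sup>2 \<le> (1 / real (Suc m))\<^sup>2"
          using that by (intro power_mono divide_left_mono) auto
        show ?thesis unfolding D_def N_def using order.trans[OF _ le] by blast
      qed
      show "(\<lambda>x. 1/2 * (a x + b x)) \<in> D n" if ab: "a \<in> D n" "b \<in> D n" for n a b
      proof -
        obtain \<alpha> \<beta> where \<alpha>: "\<alpha> \<in> N n" "a = (\<lambda>x. \<alpha> x * f x)" and \<beta>: "\<beta> \<in> N n" "b = (\<lambda>x. \<beta> x * f x)"
          using ab unfolding D_def by blast
        have "(\<lambda>x. 1/2 * (\<alpha> x + \<beta> x) * f0 x - g x) =
            (\<lambda>x. 1/2 * ((\<alpha> x * f0 x - g x) + (\<beta> x * f0 x - g x)))"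
          by (simp add: fun_eq_iff algebra_simps)
        then have "(\<lambda>x. 1/2 * (\<alpha> x + \<beta> x)) \<in> N n" (is "?m \<in> _")
          using midpoint_norm[OF N_H[OF \<alpha>(1)] N_H[OF \<beta>(1)]] \<alpha>(1) \<beta>(1)
            contractive_mult_midpoint[of \<alpha> \<beta>] unfolding N_def by auto
        moreover have "(\<lambda>x. 1/2 * (a x + b x)) = (\<lambda>x. ?m x * f x)"
          unfolding \<alpha>(2) \<beta>(2) by (simp add: fun_eq_iff algebra_simps)
        ultimately show ?thesis unfolding D_def by (intro image_eqI[of _ _ ?m])
      qed
      show "Re (ip a a) \<le> Re (ip f f)" if "a \<in> D n" for n a
        using that contractive_mult_sq(2) f unfolding D_def N_def by auto
    qed blast
    have "\<exists>\<psi>. \<psi> \<in> N n \<and> u n = (\<lambda>x. \<psi> x * f x)" for n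
      using u[of n] unfolding D_def by blast
    then have "\<exists>\<psi>. \<forall>n. \<psi> n \<in> N n \<and> u n = (\<lambda>x. \<psi> n x * f x)"
      by (intro choice allI)
    then obtain \<psi> where \<psi>: "\<And>n. \<psi> n \<in> N n" "\<And>n. u n = (\<lambda>x. \<psi> n x * f x)"
      by blast
    have \<psi>mult: "\<psi> n \<in> contractive_mult X H ip" for n using \<psi>(1)[of n] unfolding N_def by blast
    have uH: "u n \<in> H" for n unfolding \<psi>(2) using \<psi>mult f by (rule contractive_mult_sq(1))
    have \<psi>H: "(\<lambda>x. \<psi> n x * f0 x) \<in> H" for n using \<psi>mult f0(1) by (rule contractive_mult_sq(1))
    have "ip_norm ip (\<lambda>x. \<psi> n x * f0 x - g x) \<le> 1 / real (Suc n)" for n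
    proof (rule power2_le_imp_le)
      show "(ip_norm ip (\<lambda>x. \<psi> n x * f0 x - g x))\<^sup>2 \<le> (1 / real (Suc n))\<^sup>2"
        using \<psi>(1)[of n] unfolding ip_norm_sq[OF N_H[OF \<psi>(1)[of n]]] by (simp add: N_def)
    qed simp
    then have "(\<lambda>n. ip_norm ip (\<lambda>x. \<psi> n x * f0 x - g x)) \<longlonglongrightarrow> 0"
      by (intro real_tendsto_sandwich[OF _ _ tendsto_const LIMSEQ_Suc[OF lim_1_over_n]]
          always_eventually allI ip_norm_nonneg[OF N_H[OF \<psi>(1)]])
    then have \<psi>_lim: "(\<lambda>n. \<psi> n x * f0 x) \<longlonglongrightarrow> g x" if "x \<in> X" for x
      by (rule norm_convergence_pointwise[where h="\<lambda>n x. \<psi> n x * f0 x", OF \<psi>H g _ that])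
    have "v x = \<phi> x * f x" for x
    proof (cases "x \<in> X")
      case True
      have "(\<lambda>n. \<psi> n x * f0 x / f0 x * f x) \<longlonglongrightarrow> g x / f0 x * f x"
        by (rule tendsto_mult[OF tendsto_divide[OF \<psi>_lim[OF True] tendsto_const f0(2)[OF True]] tendsto_const])
      then have "(\<lambda>n. u n x) \<longlonglongrightarrow> \<phi> x * f x"
        using f0(2)[OF True] True by (simp add: \<psi>(2) \<phi>_def)
      then show ?thesis
        using norm_convergence_pointwise[OF uH v uv True] LIMSEQ_unique by blast
    next
      case False
      then show ?thesis using zero_outside[OF v False] by (simp add: \<phi>_def)
    qed
    then have "v = (\<lambda>x. \<phi> x * f x)" by (rule ext)
    then show ?thesis using v by simp
  qed
  have "\<phi> x = 0" if "x \<notin> X" for x using that by (simp add: \<phi>_def)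
  then have "\<phi> \<in> Mult X H" unfolding Mult_def using \<phi>H by blast
  then show ?thesis using \<phi>w by blast
qed

end

section \<open>From finite subsets to the whole sequence\<close>

theorem theorem1p1:
  fixes X :: "'x set"
    and H :: "('x \<Rightarrow> complex) set"
    and ip :: "('x \<Rightarrow> complex) \<Rightarrow> ('x \<Rightarrow> complex) \<Rightarrow> complex"
    and k :: "'x \<Rightarrow> 'x \<Rightarrow> complex"
    and pts :: "nat \<Rightarrow> 'x"
  assumes "rkhs X H ip k"
    and "\<forall>z\<in>X. k z z \<noteq> 0"
    and "irreducible_kernel X k"
    and "complete_pick X H ip k"
    and "\<forall>i. pts i \<in> X"
    and S: "\<exists>c>0. \<forall>n m. n \<noteq> m \<longrightarrow> c \<le> kernel_dist ip k (pts n) (pts m)"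
    and C: "\<exists>c'>0. \<forall>f\<in>H.
      summable (\<lambda>i. (cmod (f (pts i)))\<^sup>2 / (ip_norm ip (kernel_fun k (pts i)))\<^sup>2) \<and>
      (\<Sum>i. (cmod (f (pts i)))\<^sup>2 / (ip_norm ip (kernel_fun k (pts i)))\<^sup>2) \<le> c' * (ip_norm ip f)\<^sup>2"
  shows "interpolating_sequence X H pts"
proof -
  interpret rkhs X H ip k by fact
  note diag = assms(2) and pick = assms(4)
  have pX: "pts i \<in> X" for i using assms(5) by blast
  have nonzero: "\<forall>x\<in>X. \<forall>z\<in>X. k x z \<noteq> 0"
    using pick_kernel_nonvanishing[OF pick diag assms(3)] by blast
  have K: "Re (k x x) > 0" if "x \<in> X" for x using that diag kernel_diag_pos by blast
  obtain c where c: "c > 0" "\<And>n m. n \<noteq> m \<Longrightarrow> c \<le> kernel_dist ip k (pts n) (pts m)"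
    using S by blast
  from C obtain C where C0: "0 < C" and "\<forall>f\<in>H.
      summable (\<lambda>i. (cmod (f (pts i)))\<^sup>2 / (ip_norm ip (kernel_fun k (pts i)))\<^sup>2) \<and>
      (\<Sum>i. (cmod (f (pts i)))\<^sup>2 / (ip_norm ip (kernel_fun k (pts i)))\<^sup>2) \<le> C * (ip_norm ip f)\<^sup>2"
    by (elim exE conjE)
  note carl = this(2)[rule_format]
  have sep: "(cmod (k (pts n) (pts m)))\<^sup>2 / (Re (k (pts n) (pts n)) * Re (k (pts m) (pts m))) \<le> 1 - c\<^sup>2"
    if "n \<noteq> m" for n m
    using pX pX c(1) c(2)[OF that] by (rule kernel_dist_lower_bound)
  \<comment> \<open>Two equal points would have normalized kernel value of modulus 1, against the
    separation.\<close>
  have inj: "inj pts"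
  proof (rule injI, rule ccontr)
    fix n m assume eq: "pts n = pts m" and "n \<noteq> m"
    have "cmod (k (pts m) (pts m)) = Re (k (pts m) (pts m))"
      using arg_cong[where f=cmod, OF kernel_diag_real[OF pX[of m]]] K[OF pX[of m]] by simp
    moreover have "Re (k (pts m) (pts m)) \<noteq> 0" using K[OF pX[of m]] by simp
    ultimately have "1 \<le> 1 - c\<^sup>2"
      using sep[OF \<open>n \<noteq> m\<close>] unfolding eq by (simp add: power2_eq_square)
    then show False using c(1) by simp
  qed
  define L where "L = 7 / 64 * exp (- (C / 2)) * exp (- (C / c\<^sup>2))"
  have L: "L > 0" unfolding L_def by simp
  show ?thesis
    unfolding interpolating_sequence_def
  proof (intro allI impI)
    fix w :: "nat \<Rightarrow> complex" assume "Bseq w"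
    then obtain B where B: "B > 0" "\<And>i. cmod (w i) \<le> B" by (auto simp: Bseq_def)
    \<comment> \<open>Data scaled by \<open>t\<close> are bounded by \<open>t * B\<close>, and
      \<open>C * (t * B)\<^sup>2 = L\<close> lets the upper and lower Gram bounds combine into the
      Pick condition on every finite subset.\<close>
    define t where "t = sqrt (L / C) / B"
    have t: "t > 0" "C * (t * B)\<^sup>2 = L" using L C0 B(1) by (auto simp: t_def)
    have "\<exists>\<phi>\<in>contractive_mult X H ip. \<forall>i<n. \<phi> (pts i) = of_real t * w i" for n
    proof -
      define S where "S = pts ` {..<n}"
      have S: "finite S" "S \<subseteq> X" using pX by (auto simp: S_def)
      define \<phi> where "\<phi> = (\<lambda>x. of_real t * w (the_inv pts x))"
      have carlS: "(\<Sum>x\<in>S. (cmod (f x))\<^sup>2 / Re (k x x)) \<le> C * Re (ip f f)" if f: "f \<in> H" for f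
      proof -
        have "(\<Sum>x\<in>S. (cmod (f x))\<^sup>2 / Re (k x x)) =
            (\<Sum>i<n. (cmod (f (pts i)))\<^sup>2 / (ip_norm ip (kernel_fun k (pts i)))\<^sup>2)"
          unfolding S_def using inj pX
          by (subst sum.reindex) (auto simp: inj_on_def kernel_norm_sq)
        also have "\<dots> \<le> (\<Sum>i. (cmod (f (pts i)))\<^sup>2 / (ip_norm ip (kernel_fun k (pts i)))\<^sup>2)"
          using carl[OF f] by (intro sum_le_suminf) auto
        also have "\<dots> \<le> C * Re (ip f f)" using carl[OF f] ip_norm_sq[OF f] by simp
        finally show ?thesis .
      qed
      have sepS: "(cmod (k x z))\<^sup>2 / (Re (k x x) * Re (k z z)) \<le> 1 - c\<^sup>2"
        if xz: "x \<in> S" "z \<in> S" "x \<noteq> z" for x z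
      proof -
        obtain i j where "x = pts i" "z = pts j" using xz unfolding S_def by blast
        then show ?thesis using sep[of i j] xz(3) by blast
      qed
      have "kcontr k S \<phi>"
        unfolding kcontr_def
      proof
        fix a
        have "ksq k S (\<lambda>x. a x * cnj (\<phi> x)) \<le> C * (\<Sum>x\<in>S. (cmod (a x * cnj (\<phi> x)))\<^sup>2 * Re (k x x))"
          by (rule gram_upper_bound[OF S diag C0 carlS])
        also have "(\<Sum>x\<in>S. (cmod (a x * cnj (\<phi> x)))\<^sup>2 * Re (k x x)) \<le>
            (\<Sum>x\<in>S. (t * B)\<^sup>2 * ((cmod (a x))\<^sup>2 * Re (k x x)))"
        proof (rule sum_mono)
          fix x assume "x \<in> S"
          have "cmod (\<phi> x) \<le> t * B"
            using B t unfolding \<phi>_def by (simp add: norm_mult)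
          then have "(cmod (\<phi> x))\<^sup>2 \<le> (t * B)\<^sup>2" by (intro power_mono) auto
          then have "(cmod (\<phi> x))\<^sup>2 * ((cmod (a x))\<^sup>2 * Re (k x x)) \<le> (t * B)\<^sup>2 * ((cmod (a x))\<^sup>2 * Re (k x x))"
            using K[of x] S \<open>x \<in> S\<close> by (intro mult_right_mono) (auto simp: less_imp_le subset_iff)
          then show "(cmod (a x * cnj (\<phi> x)))\<^sup>2 * Re (k x x) \<le> (t * B)\<^sup>2 * ((cmod (a x))\<^sup>2 * Re (k x x))"
            by (simp add: norm_mult power_mult_distrib mult_ac)
        qed
        also have "C * (\<Sum>x\<in>S. (t * B)\<^sup>2 * ((cmod (a x))\<^sup>2 * Re (k x x))) =
            L * (\<Sum>x\<in>S. (cmod (a x))\<^sup>2 * Re (k x x))"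
          unfolding sum_distrib_left[symmetric] t(2)[symmetric] by (simp add: mult.assoc)
        also have "\<dots> \<le> ksq k S a"
          unfolding L_def
        proof (rule gram_lower_bound[OF pick nonzero S _ C0])
          show "0 < c\<^sup>2" using c(1) by simp
        qed (rule sepS carlS; assumption)+
        finally show "ksq k S (\<lambda>x. a x * cnj (\<phi> x)) \<le> ksq k S a" using C0 by simp
      qed
      then obtain \<psi> where "\<psi> \<in> contractive_mult X H ip" "\<And>x. x \<in> S \<Longrightarrow> \<psi> x = \<phi> x"
        using pick_scalar_mult[OF pick S] by blast
      then show ?thesis
        using inj by (intro bexI[of _ \<psi>]) (auto simp: S_def \<phi>_def the_inv_f_f)
    qed
    \<comment> \<open>The kernel function at \<open>pts 0\<close> is an element of \<open>H\<close>
      without zeros in \<open>X\<close>, as the limit argument requires.\<close>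
    then obtain \<phi> where \<phi>: "\<phi> \<in> Mult X H" "\<And>i. \<phi> (pts i) = of_real t * w i"
      using interpolating_multiplier_limit[of "kernel_fun k (pts 0)" pts "\<lambda>i. of_real t * w i"]
        kernel_mem[OF pX] nonzero pX by (auto simp: kernel_fun_def)
    \<comment> \<open>The scaling \<open>t\<close> is the same for all \<open>n\<close>, so it can
      be undone after the limit.\<close>
    have "(\<lambda>x. inverse (of_real t) * \<phi> x) \<in> Mult X H"
      using \<phi>(1) scale_mem[of _ "inverse (of_real t)"] unfolding Mult_def by (auto simp: mult.assoc)
    then show "\<exists>\<phi>\<in>Mult X H. \<forall>i. \<phi> (pts i) = w i"
      using \<phi>(2) t(1) by (intro bexI[of _ "\<lambda>x. inverse (of_real t) * \<phi> x"]) auto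
  qed
qed

end
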